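(* Let $S=S^{n-1}\subset\mathbb R^n$ be the unit sphere with normalized surface measure $\lambda$, and let $\mu$ be a probability measure on $S$ with density $f$ with respect to $\lambda$ satisfying $0<m\le f\le M<\infty$; let $g=1/f$. For a positive integer $d$ set $k=\lfloor d^{4/3}\rfloor$, $\phi_{x,k}(y)=\left(\frac{\langle x,y\rangle+1}{2}\right)^k$, $h_{x,k}=\phi_{x,k}/f$, and $$\widehat g_d(x)=\frac{\|\Pi_dh_{x,k}\|^2_{\mathscr L^2(\mu)}}{\|\phi_{x,k}\|^2_{\mathscr L^2(\lambda)}},$$ where $\Pi_d$ is the $\mathscr L^2(\mu)$-orthogonal projection onto spherical polynomials of degree at most $d$. Then, uniformly in $x\in S$: if $g\in C^1(S)$, $|\widehat g_d(x)-g(x)|=O(d^{-2/3})$; if $g\in C^2(S)$, $|\widehat g_d(x)-g(x)|=O(d^{-4/3})$. The implicit constants depend only on $n$, $m$, $M$ and the Sobolev/bounded-derivative constants of $g$.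
   Context: Spherical polynomials of degree at most $d$ are restrictions to $S$ of real polynomials of degree at most $d$ on $\mathbb R^n$. *)

theory Defs
  imports "HOL-Probability.Probability"
begin

text \<open>Normalized surface measure on the unit sphere of real^'n, realised as the cone measure:
  the push-forward of the normalized Lebesgue measure on the unit ball under x |-> x/|x|.
  It is a probability measure on the Borel sets of real^'n concentrated on sphere 0 1.\<close>
definition sphere_measure :: "(real^'n) measure" where
  "sphere_measure = distr (uniform_measure lborel (ball 0 1)) borel (\<lambda>x. x /\<^sub>R norm x)"

text \<open>Real polynomials of degree at most d on real^'n (their restrictions to the sphere are the
  spherical polynomials of degree at most d).\<close>
definition poly_le :: "nat \<Rightarrow> (real^'n \<Rightarrow> real) set" where
  "poly_le d = {p. \<exists>c :: ('n \<Rightarrow> nat) \<Rightarrow> real.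
      p = (\<lambda>x. \<Sum>\<alpha>\<in>{\<alpha>. sum \<alpha> UNIV \<le> d}. c \<alpha> * (\<Prod>i\<in>UNIV. (x $ i) ^ \<alpha> i))}"

definition proj_sq_norm :: "(real^'n) measure \<Rightarrow> nat \<Rightarrow> (real^'n \<Rightarrow> real) \<Rightarrow> real" where
  "proj_sq_norm \<mu> d h =
     (let p = (SOME p. p \<in> poly_le d \<and>
                  (\<forall>q\<in>poly_le d. (\<integral>y. (h y - p y) * q y \<partial>\<mu>) = 0))
      in \<integral>y. (p y)^2 \<partial>\<mu>)"

definition phi :: "real^'n \<Rightarrow> nat \<Rightarrow> real^'n \<Rightarrow> real" where
  "phi x k y = ((inner x y + 1) / 2) ^ k"

definition ghat :: "(real^'n \<Rightarrow> real) \<Rightarrow> nat \<Rightarrow> real^'n \<Rightarrow> real" where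
  "ghat f d x =
     (let k = nat \<lfloor>real d powr (4/3)\<rfloor>;
          h = (\<lambda>y. phi x k y / f y)
      in proj_sq_norm (density sphere_measure (\<lambda>y. ennreal (f y))) d h
         / (\<integral>y. (phi x k y)^2 \<partial>sphere_measure))"

text \<open>0-homogeneous extension of a function on the sphere; g is C^k on S iff this is C^k on R^n - {0}.\<close>
definition sph_ext :: "(real^'n \<Rightarrow> real) \<Rightarrow> real^'n \<Rightarrow> real" where
  "sph_ext g x = g (x /\<^sub>R norm x)"

definition C1_on :: "'a::real_normed_vector set \<Rightarrow> ('a \<Rightarrow> 'b::real_normed_vector)
                      \<Rightarrow> ('a \<Rightarrow> ('a \<Rightarrow>\<^sub>L 'b)) \<Rightarrow> bool" where
  "C1_on U F F' \<longleftrightarrow> (\<forall>x\<in>U. (F has_derivative blinfun_apply (F' x)) (at x)) \<and> continuous_on U F'"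

end

theory Submission
  imports Defs
begin

text \<open>
  Write \<open>g = 1 / f\<close>, \<open>t = \<langle>x, y\<rangle>\<close> and \<open>K = \<integral> \<phi>\<^sup>2 d\<lambda>\<close>. By Pythagoras, for every polynomial \<open>q\<close> of
  degree at most \<open>d\<close>,
  \<open>\<integral> \<phi>\<^sup>2 g d\<lambda> - \<parallel>h - q\<parallel>\<^sup>2 \<le> \<parallel>\<Pi> h\<parallel>\<^sup>2 \<le> \<integral> \<phi>\<^sup>2 g d\<lambda>\<close>.
  Rotation invariance of \<open>\<lambda>\<close>, differentiated along the rotations of planes through \<open>x\<close>, yields
  \<open>\<integral> (1 - t) \<phi>\<^sup>2 d\<lambda> = O(K / k)\<close>; so the weighted mean \<open>\<integral> \<phi>\<^sup>2 g d\<lambda> / K\<close> differs from \<open>g x\<close> by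
  \<open>O(k powr (-1/2))\<close> in the \<open>C\<^sup>1\<close> case, and by \<open>O(1 / k)\<close> in the \<open>C\<^sup>2\<close> case, because the reflection
  \<open>y \<mapsto> 2 t x - y\<close> preserves \<open>\<lambda>\<close> and cancels the first-order term. Finally take \<open>q = g x \<cdot> Q\<close>, where
  \<open>Q\<close> is the Chebyshev expansion of \<open>((1 + t) / 2) ^ k\<close> truncated at degree \<open>d\<close>. The Lipschitz bound
  for \<open>g\<close> makes \<open>\<parallel>(g - g x) \<phi>\<parallel>\<^sup>2 = O(K / k)\<close>, and the truncation error is a binomial tail of size
  \<open>2 exp (- d\<^sup>2 / k)\<close>, negligible against \<open>K\<close>, which decays only polynomially in \<open>k\<close>.
\<close>

section \<open>The surface measure\<close>

text \<open>The Jacobian is \<open>\<bar>c\<bar> ^ DIM('a) = 1\<close>. The Fubini argument for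
  orthogonal maps uses both signs: \<open>c = 1\<close> for translations, \<open>c = -1\<close> for
  the substitution \<open>y \<mapsto> T x - y\<close>.\<close>

lemma nn_integral_lborel_isometry:
  fixes t :: "'a::euclidean_space"
  assumes [measurable]: "u \<in> borel_measurable borel" and c: "\<bar>c\<bar> = 1"
  shows "(\<integral>\<^sup>+y. u (t + c *\<^sub>R y) \<partial>lborel) = (\<integral>\<^sup>+y. u y \<partial>lborel)"
proof -
  have "lborel = distr lborel borel (\<lambda>x. t + c *\<^sub>R x)"
    using lborel_affine[of c t] c by (auto simp: density_1)
  then have "(\<integral>\<^sup>+y. u y \<partial>lborel) = (\<integral>\<^sup>+y. u y \<partial>distr lborel borel (\<lambda>x. t + c *\<^sub>R x))"
    by simp
  also have "\<dots> = (\<integral>\<^sup>+y. u (t + c *\<^sub>R y) \<partial>lborel)"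
    by (subst nn_integral_distr) auto
  finally show ?thesis by simp
qed

lemma emeasure_unit_ball:
  shows "emeasure lborel (ball (0::'a::euclidean_space) 1) \<noteq> 0"
    and "emeasure lborel (ball (0::'a) 1) \<noteq> \<infinity>"
  using emeasure_lborel_ball_finite[of "0::'a" 1] content_ball_pos[of 1 "0::'a"]
  by (auto simp: measure_def)

lemma orthogonal_transformation_measurable:
  fixes T :: "'a::euclidean_space \<Rightarrow> 'a"
  assumes "orthogonal_transformation T"
  shows "T \<in> borel_measurable borel"
  using orthogonal_transformation_linear[OF assms]
  by (intro borel_measurable_continuous_onI linear_continuous_on) (simp add: linear_conv_bounded_linear)

text \<open>Fubini and translation invariance give \<open>|T\<^sup>-\<^sup>1 A| |B| = |A| |T\<^sup>-\<^sup>1 B|\<close> for Borel sets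
  \<open>A\<close>, \<open>B\<close>; for the unit ball \<open>B = T\<^sup>-\<^sup>1 B\<close> this cancels.\<close>
lemma distr_lborel_orthogonal:
  fixes T :: "'a::euclidean_space \<Rightarrow> 'a"
  assumes T: "orthogonal_transformation T"
  shows "distr lborel borel T = lborel"
proof (rule measure_eqI)
  fix A assume "A \<in> sets (distr lborel borel T)"
  then have A[measurable]: "A \<in> sets borel" by simp
  have lin: "linear T" using T by (simp add: orthogonal_transformation_linear)
  note T'[measurable] = orthogonal_transformation_measurable[OF T]
  have n: "norm (T x) = norm x" for x using T by (simp add: orthogonal_transformation)
  have surj: "T (inv T y) = y" for y
    using T by (simp add: orthogonal_transformation_surj surj_f_inv_f)
  define B where "B = ball (0::'a) 1"
  have [measurable]: "B \<in> sets borel" by (simp add: B_def)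
  have TB: "indicator B (T x) = (indicator B x :: ennreal)" for x
    by (simp add: B_def indicator_def n)
  have "emeasure (distr lborel borel T) A * emeasure lborel B
      = (\<integral>\<^sup>+x. indicator A (T x) * emeasure lborel B \<partial>lborel)"
  proof -
    have "emeasure (distr lborel borel T) A = (\<integral>\<^sup>+x. indicator A x \<partial>distr lborel borel T)"
      by simp
    also have "\<dots> = (\<integral>\<^sup>+x. indicator A (T x) \<partial>lborel)"
      by (subst nn_integral_distr) auto
    finally show ?thesis by (simp add: nn_integral_multc)
  qed
  also have "\<dots> = (\<integral>\<^sup>+x. (\<integral>\<^sup>+y. indicator A (T x) * indicator B (T x + y) \<partial>lborel) \<partial>lborel)"
  proof (intro nn_integral_cong)
    fix x
    have "(\<integral>\<^sup>+y. indicator A (T x) * indicator B (T x + y) \<partial>lborel)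
      = indicator A (T x) * (\<integral>\<^sup>+y. indicator B (T x + 1 *\<^sub>R y) \<partial>lborel)"
      by (subst nn_integral_cmult) auto
    also have "\<dots> = indicator A (T x) * emeasure lborel B"
      by (subst nn_integral_lborel_isometry) auto
    finally show "indicator A (T x) * emeasure lborel B
       = (\<integral>\<^sup>+y. indicator A (T x) * indicator B (T x + y) \<partial>lborel)" by simp
  qed
  also have "\<dots> = (\<integral>\<^sup>+y. (\<integral>\<^sup>+x. indicator A (T x) * indicator B (T x + y) \<partial>lborel) \<partial>lborel)"
    by (intro lborel_pair.Fubini'[symmetric]) measurable
  \<comment> \<open>Replacing \<open>x\<close> by \<open>x - inv T y\<close> moves the shift from
    \<open>B\<close> to \<open>A\<close>, by linearity of \<open>T\<close>.\<close>
  also have "\<dots> = (\<integral>\<^sup>+y. (\<integral>\<^sup>+x. indicator A (T x - y) * indicator B (T x) \<partial>lborel) \<partial>lborel)"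
  proof (rule nn_integral_cong)
    fix y
    have "(\<integral>\<^sup>+x. indicator A (T x) * indicator B (T x + y) \<partial>lborel)
       = (\<integral>\<^sup>+x. indicator A (T (- inv T y + 1 *\<^sub>R x)) * indicator B (T (- inv T y + 1 *\<^sub>R x) + y) \<partial>lborel)"
      by (rule nn_integral_lborel_isometry[symmetric]) auto
    also have "\<dots> = (\<integral>\<^sup>+x. indicator A (T x - y) * indicator B (T x) \<partial>lborel)"
      by (intro nn_integral_cong) (simp add: linear_diff[OF lin] surj)
    finally show "(\<integral>\<^sup>+x. indicator A (T x) * indicator B (T x + y) \<partial>lborel)
       = (\<integral>\<^sup>+x. indicator A (T x - y) * indicator B (T x) \<partial>lborel)" .
  qed
  also have "\<dots> = (\<integral>\<^sup>+x. (\<integral>\<^sup>+y. indicator A (T x - y) * indicator B (T x) \<partial>lborel) \<partial>lborel)"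
    by (intro lborel_pair.Fubini') measurable
  also have "\<dots> = (\<integral>\<^sup>+x. emeasure lborel A * indicator B x \<partial>lborel)"
  proof (intro nn_integral_cong)
    fix x
    have "(\<integral>\<^sup>+y. indicator A (T x - y) * indicator B (T x) \<partial>lborel)
      = (\<integral>\<^sup>+y. indicator A (T x + (-1) *\<^sub>R y) \<partial>lborel) * indicator B (T x)"
      by (subst nn_integral_multc) auto
    also have "\<dots> = emeasure lborel A * indicator B (T x)"
      by (subst nn_integral_lborel_isometry) auto
    finally show "(\<integral>\<^sup>+y. indicator A (T x - y) * indicator B (T x) \<partial>lborel) = emeasure lborel A * indicator B x"
      by (simp add: TB)
  qed
  also have "\<dots> = emeasure lborel A * emeasure lborel B"
    by (subst nn_integral_cmult) auto
  finally show "emeasure (distr lborel borel T) A = emeasure lborel A"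
    using emeasure_unit_ball[where 'a='a] unfolding B_def
    by (simp add: mult.commute[of _ "emeasure lborel (ball 0 1)"] ennreal_mult_cancel_left)
qed simp

section \<open>The cone measure on the sphere\<close>

lemma sets_sphere_measure [measurable_cong, simp]: "sets sphere_measure = sets borel"
  and space_sphere_measure [simp]: "space sphere_measure = UNIV"
  by (simp_all add: sphere_measure_def)

lemma prob_space_sphere_measure: "prob_space (sphere_measure :: (real^'n) measure)"
  unfolding sphere_measure_def
  by (intro prob_space.prob_space_distr prob_space_uniform_measure emeasure_unit_ball) measurable

text \<open>Only the origin escapes normalisation, since \<open>x /\<^sub>R norm x\<close> is
  \<open>0\<close> there by the convention on division, and a single point is a Lebesgue null
  set.\<close>

lemma AE_sphere_measure: "AE y in sphere_measure. (y::real^'n) \<in> sphere 0 1"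
proof -
  have "AE x in lborel. x \<noteq> (0::real^'n)"
    by (rule AE_lborel_singleton)
  then have "AE x in uniform_measure lborel (ball 0 1). x /\<^sub>R norm x \<in> sphere (0::real^'n) 1"
    by (intro AE_uniform_measureI) (auto elim: eventually_mono)
  then show ?thesis unfolding sphere_measure_def
    by (subst AE_distr_iff) auto
qed

lemma emeasure_sphere_measure:
  assumes [measurable]: "A \<in> sets borel"
  shows "emeasure sphere_measure A = emeasure lborel (ball (0::real^'n) 1 \<inter> (\<lambda>x. x /\<^sub>R norm x) -` A) / emeasure lborel (ball (0::real^'n) 1)"
proof -
  have m: "(\<lambda>x::real^'n. x /\<^sub>R norm x) -` A \<in> sets borel"
    using measurable_sets[of "\<lambda>x::real^'n. x /\<^sub>R norm x" borel borel A] by simp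
  show ?thesis unfolding sphere_measure_def
    using m by (subst emeasure_distr) (auto simp: space_uniform_measure)
qed

text \<open>Orthogonal maps preserve the unit ball and commute with
  \<open>x \<mapsto> x /\<^sub>R norm x\<close>, so the invariance is inherited from Lebesgue
  measure.\<close>

lemma distr_sphere_measure_orthogonal:
  fixes T :: "real^'n \<Rightarrow> real^'n"
  assumes T: "orthogonal_transformation T"
  shows "distr sphere_measure borel T = sphere_measure"
proof (rule measure_eqI)
  fix A assume "A \<in> sets (distr sphere_measure borel T)"
  then have A[measurable]: "A \<in> sets borel" by simp
  have lin: "linear T" using T by (simp add: orthogonal_transformation_linear)
  note T'[measurable] = orthogonal_transformation_measurable[OF T]
  have TA: "T -` A \<in> sets borel" using measurable_sets[OF T' A] by simp
  have m: "(\<lambda>x::real^'n. x /\<^sub>R norm x) -` A \<in> sets borel"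
    using measurable_sets[of "\<lambda>x::real^'n. x /\<^sub>R norm x" borel borel A] by simp
  have n: "norm (T x) = norm x" for x using T by (simp add: orthogonal_transformation)
  have eq: "ball 0 1 \<inter> (\<lambda>x. x /\<^sub>R norm x) -` (T -` A) = T -` (ball 0 1 \<inter> (\<lambda>x. x /\<^sub>R norm x) -` A)"
    using n by (auto simp: linear_cmul[OF lin])
  have "emeasure (distr sphere_measure borel T) A = emeasure sphere_measure (T -` A)"
    by (subst emeasure_distr) auto
  also have "\<dots> = emeasure lborel (T -` (ball 0 1 \<inter> (\<lambda>x. x /\<^sub>R norm x) -` A)) / emeasure lborel (ball (0::real^'n) 1)"
    by (subst emeasure_sphere_measure[OF TA]) (simp only: eq)
  also have "emeasure lborel (T -` (ball 0 1 \<inter> (\<lambda>x. x /\<^sub>R norm x) -` A)) =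
     emeasure (distr lborel borel T) (ball 0 1 \<inter> (\<lambda>x. x /\<^sub>R norm x) -` A)"
    using m by (subst emeasure_distr) auto
  finally show "emeasure (distr sphere_measure borel T) A = emeasure sphere_measure A"
    unfolding distr_lborel_orthogonal[OF T] emeasure_sphere_measure[OF A] .
qed simp

lemma integral_sphere_measure_orthogonal:
  fixes T :: "real^'n \<Rightarrow> real^'n" and u :: "real^'n \<Rightarrow> real"
  assumes T: "orthogonal_transformation T" and u: "u \<in> borel_measurable borel"
  shows "(\<integral>y. u (T y) \<partial>sphere_measure) = (\<integral>y. u y \<partial>sphere_measure)"
proof -
  have T': "T \<in> measurable sphere_measure borel"
    using orthogonal_transformation_measurable[OF T] by (simp cong: measurable_cong_sets)
  show ?thesis
    using integral_distr[OF T' u] by (simp add: distr_sphere_measure_orthogonal[OF T])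
qed

text \<open>Measurability is asked on the whole space but the bound only on the sphere, because
  \<open>f\<close> is controlled only there and the measure lives there. The class is an algebra of
  integrable functions, and it serves as the ambient space of the least squares problem.\<close>

definition sphere_bounded :: "(real^'n \<Rightarrow> real) \<Rightarrow> bool" where
  "sphere_bounded u \<longleftrightarrow> u \<in> borel_measurable borel \<and> (\<exists>B. \<forall>y\<in>sphere 0 1. \<bar>u y\<bar> \<le> B)"

lemma sphere_bounded_add:
  assumes "sphere_bounded u" "sphere_bounded v"
  shows "sphere_bounded (\<lambda>y. u y + v y)"
proof -
  obtain B C where "\<And>y. y \<in> sphere 0 1 \<Longrightarrow> \<bar>u y\<bar> \<le> B" "\<And>y. y \<in> sphere 0 1 \<Longrightarrow> \<bar>v y\<bar> \<le> C"
    using assms unfolding sphere_bounded_def by blast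
  then have "\<forall>y\<in>sphere 0 1. \<bar>u y + v y\<bar> \<le> B + C"
    by (meson abs_triangle_ineq add_mono order_trans)
  with assms show ?thesis by (auto simp: sphere_bounded_def)
qed

lemma sphere_bounded_mult:
  assumes "sphere_bounded u" "sphere_bounded v"
  shows "sphere_bounded (\<lambda>y. u y * v y)"
proof -
  obtain B C where "\<And>y. y \<in> sphere 0 1 \<Longrightarrow> \<bar>u y\<bar> \<le> B" "\<And>y. y \<in> sphere 0 1 \<Longrightarrow> \<bar>v y\<bar> \<le> C"
    using assms unfolding sphere_bounded_def by blast
  then have "\<forall>y\<in>sphere 0 1. \<bar>u y * v y\<bar> \<le> B * C"
    unfolding abs_mult by (metis abs_ge_zero mult_mono order_trans)
  with assms show ?thesis by (auto simp: sphere_bounded_def)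
qed

lemma sphere_bounded_continuous:
  assumes "continuous_on UNIV u"
  shows "sphere_bounded u"
proof -
  have "compact (u ` sphere 0 1)"
    using assms by (intro compact_continuous_image) (auto intro: continuous_on_subset)
  then obtain B where "\<forall>y\<in>sphere 0 1. \<bar>u y\<bar> \<le> B"
    by (metis bounded_iff compact_imp_bounded image_eqI real_norm_def)
  with assms show ?thesis by (auto simp: sphere_bounded_def intro: borel_measurable_continuous_onI)
qed

lemma sphere_bounded_const: "sphere_bounded (\<lambda>y. c)"
  by (rule sphere_bounded_continuous) simp

lemma sphere_bounded_diff:
  assumes "sphere_bounded u" "sphere_bounded v"
  shows "sphere_bounded (\<lambda>y. u y - v y)"
  using sphere_bounded_add[OF assms(1) sphere_bounded_mult[OF sphere_bounded_const[of "-1"] assms(2)]] by simp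

lemma sphere_bounded_power2: "sphere_bounded u \<Longrightarrow> sphere_bounded (\<lambda>y. (u y)\<^sup>2)"
  unfolding power2_eq_square by (rule sphere_bounded_mult)

lemmas sphere_bounded_intros =
  sphere_bounded_add sphere_bounded_mult sphere_bounded_const sphere_bounded_diff sphere_bounded_power2

lemma sphere_bounded_integrable:
  fixes u :: "real^'n \<Rightarrow> real"
  assumes u: "sphere_bounded u"
  shows "integrable sphere_measure u"
proof -
  interpret prob_space "sphere_measure :: (real^'n) measure" by (rule prob_space_sphere_measure)
  obtain B where "\<forall>y\<in>sphere 0 1. \<bar>u y\<bar> \<le> B" "u \<in> borel_measurable borel"
    using u unfolding sphere_bounded_def by blast
  then show ?thesis
    by (intro integrable_const_bound[of _ B])
      (use AE_sphere_measure in \<open>auto elim!: eventually_mono cong: measurable_cong_sets\<close>)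
qed

lemma integrable_sphere_measure_continuous:
  fixes u :: "real^'n \<Rightarrow> real"
  shows "continuous_on UNIV u \<Longrightarrow> integrable sphere_measure u"
  by (intro sphere_bounded_integrable sphere_bounded_continuous)

section \<open>Moments of the kernel\<close>

text \<open>Differentiation under the integral sign: the mean value theorem bounds the difference
  quotients at 0 by \<open>B\<close>, so dominated convergence applies, and each quotient has
  integral zero because the integral of \<open>F s\<close> does not change with
  \<open>s\<close>.\<close>

lemma integral_derivative_zero:
  fixes F G :: "real \<Rightarrow> 'a \<Rightarrow> real"
  assumes "finite_measure M"
    and deriv: "\<And>s y. ((\<lambda>s. F s y) has_real_derivative G s y) (at s)"
    and bd: "AE y in M. \<forall>s. \<bar>G s y\<bar> \<le> B"
    and int: "\<And>s. integrable M (F s)"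
    and const: "\<And>s. (\<integral>y. F s y \<partial>M) = (\<integral>y. F 0 y \<partial>M)"
  shows "(\<integral>y. G 0 y \<partial>M) = 0"
proof -
  interpret finite_measure M by fact
  define \<delta> :: "nat \<Rightarrow> real" where "\<delta> i = 1 / real (Suc i)" for i
  have \<delta>: "\<delta> i > 0" for i by (simp add: \<delta>_def)
  define D where "D i y = (F (\<delta> i) y - F 0 y) / \<delta> i" for i y
  have \<delta>0: "\<delta> \<longlonglongrightarrow> 0" unfolding \<delta>_def using LIMSEQ_inverse_real_of_nat by (simp add: inverse_eq_divide)
  have lim: "(\<lambda>i. D i y) \<longlonglongrightarrow> G 0 y" for y
  proof -
    have "((\<lambda>h. (F (0 + h) y - F 0 y) / h) \<longlongrightarrow> G 0 y) (at 0)"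
      using deriv[of y 0] by (simp add: DERIV_def)
    moreover have "filterlim \<delta> (at 0) sequentially"
      using \<delta>0 \<delta> by (intro filterlim_atI) (auto simp: less_imp_neq[symmetric])
    ultimately show ?thesis
      unfolding D_def by (auto dest: filterlim_compose)
  qed
  have [measurable]: "F s \<in> borel_measurable M" for s using int by auto
  have [measurable]: "D i \<in> borel_measurable M" for i unfolding D_def by measurable
  have Dbd: "AE y in M. norm (D i y) \<le> B" for i
    using bd
  proof eventually_elim
    case (elim y)
    obtain z where "F (\<delta> i) y - F 0 y = (\<delta> i - 0) * G z y"
      using MVT2[of 0 "\<delta> i" "\<lambda>s. F s y" "\<lambda>s. G s y"] \<delta> deriv by auto
    then have "D i y = G z y" using \<delta>[of i] by (simp add: D_def)
    with elim show ?case by simp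
  qed
  have "(\<lambda>i. \<integral>y. D i y \<partial>M) \<longlonglongrightarrow> (\<integral>y. G 0 y \<partial>M)"
  proof (rule integral_dominated_convergence[where w = "\<lambda>_. B"])
    show "G 0 \<in> borel_measurable M"
      by (rule borel_measurable_LIMSEQ_real[of _ D]) (use lim in auto)
  qed (use lim Dbd in auto)
  moreover have "(\<integral>y. D i y \<partial>M) = 0" for i
    unfolding D_def using int const[of "\<delta> i"] by simp
  ultimately show ?thesis by (simp add: LIMSEQ_const_iff)
qed

text \<open>Integration by parts on the sphere: by invariance the integral of
  \<open>(e \<bullet> y) * ((x \<bullet> y + 1) / 2) ^ j\<close> is constant along the rotations of
  the plane of \<open>x\<close> and \<open>e\<close>, and its derivative at angle 0 is the
  difference of the two sides.\<close>

lemma integral_sphere_measure_rotation: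
  fixes x e :: "real^'n"
  assumes x: "norm x = 1" and e: "norm e = 1" and xe: "x \<bullet> e = 0"
  shows "(\<integral>y. (x \<bullet> y) * ((x \<bullet> y + 1) / 2) ^ j \<partial>sphere_measure)
       = (\<integral>y. (e \<bullet> y)\<^sup>2 * (real j / 2 * ((x \<bullet> y + 1) / 2) ^ (j - 1)) \<partial>sphere_measure)"
proof -
  have xx: "x \<bullet> x = 1" "e \<bullet> e = 1" "e \<bullet> x = 0"
    using x e xe by (simp_all add: norm_eq_1 inner_commute)
  \<comment> \<open>Rotation by the angle \<open>s\<close> in the plane spanned by \<open>x\<close>
    and \<open>e\<close>, and the identity on the orthogonal complement; it sends \<open>x\<close>
    to \<open>cos s *\<^sub>R x + sin s *\<^sub>R e\<close>.\<close>
  define R where "R s y = y + (cos s - 1) *\<^sub>R ((x \<bullet> y) *\<^sub>R x + (e \<bullet> y) *\<^sub>R e)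
     + sin s *\<^sub>R ((x \<bullet> y) *\<^sub>R e - (e \<bullet> y) *\<^sub>R x)" for s y
  have xR: "x \<bullet> R s y = cos s * (x \<bullet> y) - sin s * (e \<bullet> y)"
    and eR: "e \<bullet> R s y = cos s * (e \<bullet> y) + sin s * (x \<bullet> y)" for s y
    unfolding R_def using xx xe by (simp_all add: inner_simps algebra_simps)
  have orth: "orthogonal_transformation (R s)" for s
    unfolding orthogonal_transformation
  proof (intro conjI allI)
    show "linear (R s)"
      unfolding R_def by (intro linearI) (simp_all add: inner_simps algebra_simps)
    fix y
    have "R s y \<bullet> R s y = (y \<bullet> R s y) + (cos s - 1) * ((x \<bullet> y) * (x \<bullet> R s y) + (e \<bullet> y) * (e \<bullet> R s y))
     + sin s * ((x \<bullet> y) * (e \<bullet> R s y) - (e \<bullet> y) * (x \<bullet> R s y))"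
      by (subst R_def) (simp add: inner_simps)
    also have "y \<bullet> R s y = y \<bullet> y + (cos s - 1) * ((x \<bullet> y)\<^sup>2 + (e \<bullet> y)\<^sup>2)"
      unfolding R_def by (simp add: inner_simps inner_commute power2_eq_square algebra_simps)
    finally have "R s y \<bullet> R s y = y \<bullet> y + ((x \<bullet> y)\<^sup>2 + (e \<bullet> y)\<^sup>2) * ((sin s)\<^sup>2 + (cos s)\<^sup>2 - 1)"
      unfolding xR eR power2_eq_square by algebra
    then show "norm (R s y) = norm y" by (simp only: norm_eq sin_cos_squared_add) simp
  qed
  define u where "u y = (e \<bullet> y) * ((x \<bullet> y + 1) / 2) ^ j" for y
  define F where "F s y = u (R s y)" for s y
  define G where "G s y = (cos s * (x \<bullet> y) - sin s * (e \<bullet> y)) * ((x \<bullet> R s y + 1) / 2) ^ j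
     - (e \<bullet> R s y) * (real j * ((x \<bullet> R s y + 1) / 2) ^ (j - 1) * ((sin s * (x \<bullet> y) + cos s * (e \<bullet> y)) / 2))" for s y
  have cu: "continuous_on UNIV u" unfolding u_def by (intro continuous_intros) auto
  \<comment> \<open>The dominating constant is \<open>1 + real j\<close>, written out so that it
    matches the two terms of \<open>G\<close> factor by factor.\<close>
  have "(\<integral>y. G 0 y \<partial>sphere_measure) = 0"
  proof (rule integral_derivative_zero[where F = F and B = "1 * 1 ^ j + 1 * (real j * 1 ^ (j - 1) * 1)"])
    show "finite_measure (sphere_measure :: (real^'n) measure)"
      using prob_space_sphere_measure prob_space_def by blast
    show "((\<lambda>s. F s y) has_real_derivative G s y) (at s)" for s y
      unfolding F_def G_def u_def xR eR
      by (auto intro!: derivative_eq_intros simp: algebra_simps add_divide_distrib diff_divide_distrib)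
    show "AE y in sphere_measure. \<forall>s. \<bar>G s y\<bar> \<le> 1 * 1 ^ j + 1 * (real j * 1 ^ (j - 1) * 1)"
      using AE_sphere_measure
    proof eventually_elim
      case (elim y)
      show ?case
      proof
        fix s
        have n: "norm (R s y) = 1" using orth[of s] elim by (simp add: orthogonal_transformation)
        have 1: "\<bar>x \<bullet> R s y\<bar> \<le> 1" "\<bar>e \<bullet> R s y\<bar> \<le> 1"
          using Cauchy_Schwarz_ineq2[of x "R s y"] Cauchy_Schwarz_ineq2[of e "R s y"] n x e by auto
        then have 2: "\<bar>(x \<bullet> R s y + 1) / 2\<bar> \<le> 1" by auto
        \<comment> \<open>Written this way, \<open>G s y\<close> depends on \<open>s\<close> only
          through the point \<open>R s y\<close>, which stays on the sphere; hence the bound is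
          uniform in \<open>s\<close>.\<close>
        have G: "G s y = (x \<bullet> R s y) * ((x \<bullet> R s y + 1) / 2) ^ j
          - (e \<bullet> R s y) * (real j * ((x \<bullet> R s y + 1) / 2) ^ (j - 1) * ((e \<bullet> R s y) / 2))"
          unfolding G_def xR eR by (simp add: algebra_simps)
        have "\<bar>(x \<bullet> R s y) * ((x \<bullet> R s y + 1) / 2) ^ j\<bar> \<le> 1 * 1 ^ j"
          unfolding abs_mult power_abs using 1 2 by (intro mult_mono power_mono) auto
        moreover have "\<bar>(e \<bullet> R s y) * (real j * ((x \<bullet> R s y + 1) / 2) ^ (j - 1) * ((e \<bullet> R s y) / 2))\<bar>
            \<le> 1 * (real j * 1 ^ (j - 1) * 1)"
          unfolding abs_mult power_abs abs_of_nat using 1 2 by (intro mult_mono power_mono) auto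
        ultimately show "\<bar>G s y\<bar> \<le> 1 * 1 ^ j + 1 * (real j * 1 ^ (j - 1) * 1)"
          unfolding G by linarith
      qed
    qed
    have cF: "continuous_on UNIV (R s)" for s using orth
      by (intro linear_continuous_on) (simp add: linear_conv_bounded_linear[symmetric] orthogonal_transformation_linear)
    show "integrable sphere_measure (F s)" for s
      unfolding F_def using cF cu
      by (intro integrable_sphere_measure_continuous continuous_on_compose2[OF cu]) auto
    show "(\<integral>y. F s y \<partial>sphere_measure) = (\<integral>y. F 0 y \<partial>sphere_measure)" for s
      unfolding F_def using orth cu
      by (simp add: integral_sphere_measure_orthogonal borel_measurable_continuous_onI)
  qed
  moreover have "G 0 y = (x \<bullet> y) * ((x \<bullet> y + 1) / 2) ^ j - (e \<bullet> y)\<^sup>2 * (real j / 2 * ((x \<bullet> y + 1) / 2) ^ (j - 1))" for y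
    unfolding G_def xR eR by (simp add: power2_eq_square)
  moreover have "integrable sphere_measure (\<lambda>y. (x \<bullet> y) * ((x \<bullet> y + 1) / 2) ^ j)"
    "integrable sphere_measure (\<lambda>y. (e \<bullet> y)\<^sup>2 * (real j / 2 * ((x \<bullet> y + 1) / 2) ^ (j - 1)))"
    by (intro integrable_sphere_measure_continuous continuous_intros; simp)+
  ultimately show ?thesis by simp
qed

lemma phi_continuous [continuous_intros]: "continuous_on A (phi x k)"
  unfolding phi_def by (intro continuous_intros) auto

text \<open>Write \<open>t = x \<bullet> y\<close>. Summing the rotation identity over the unit
  vectors completing \<open>x\<close> to an orthonormal basis produces the weight
  \<open>1 - t ^ 2 = (1 - t) * (1 + t)\<close>, and the factor \<open>(1 + t) / 2\<close> restores
  the power of the kernel lost by differentiation. For \<open>j = 0\<close> both sides vanish, the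
  left one by antipodal symmetry.\<close>

lemma phi_moment_identity:
  fixes x :: "real^'n"
  assumes x: "norm x = 1"
  shows "real (CARD('n) - 1) * (\<integral>y. (x \<bullet> y) * phi x j y \<partial>sphere_measure)
       = real j * (\<integral>y. (1 - x \<bullet> y) * phi x j y \<partial>sphere_measure)"
proof (cases "j = 0")
  case True
  have "(\<integral>y. x \<bullet> y \<partial>sphere_measure) = (\<integral>y. x \<bullet> (- y) \<partial>sphere_measure)"
    by (rule integral_sphere_measure_orthogonal[symmetric])
      (auto simp: orthogonal_transformation linear_conv_bounded_linear bounded_linear_minus bounded_linear_ident)
  then show ?thesis using True by (simp add: phi_def)
next
  case False
  obtain i :: 'n where True by simp
  \<comment> \<open>Transporting the standard basis by an orthogonal map that hits \<open>x\<close>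
    gives an orthonormal basis \<open>e\<close> with \<open>e i = x\<close>.\<close>
  obtain T where T: "orthogonal_transformation T" "T (axis i (1::real)) = x"
    using orthogonal_transformation_exists_1[of "axis i 1" x] x by auto
  define e where "e k = T (axis k (1::real))" for k
  have inner: "e k \<bullet> e l = (if k = l then 1 else 0)" for k l
    using T(1) unfolding e_def orthogonal_transformation_def by (simp add: inner_axis_axis)
  have ne: "norm (e k) = 1" for k using inner[of k k] by (simp add: norm_eq_1)
  \<comment> \<open>Parseval for the basis \<open>e\<close>; on the sphere the vectors other than
    \<open>x\<close> account for \<open>1 - (x \<bullet> y) ^ 2\<close>.\<close>
  have sumsq: "(\<Sum>k\<in>UNIV. (e k \<bullet> y)\<^sup>2) = y \<bullet> y" for y
  proof -
    obtain z where z: "y = T z" using T(1) orthogonal_transformation_surj[of T] by (metis surjD)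
    have "e k \<bullet> y = z $ k" for k
      using T(1) unfolding e_def z orthogonal_transformation_def by (simp add: inner_axis' )
    moreover have "y \<bullet> y = z \<bullet> z" using T(1) unfolding z orthogonal_transformation_def by simp
    ultimately show ?thesis by (simp add: inner_vec_def power2_eq_square)
  qed
  have ei: "e i = x" using T by (simp add: e_def)
  let ?q = "\<lambda>y. real j / 2 * ((x \<bullet> y + 1) / 2) ^ (j - 1)"
  have "real (CARD('n) - 1) * (\<integral>y. (x \<bullet> y) * phi x j y \<partial>sphere_measure)
     = (\<Sum>k\<in>UNIV - {i}. \<integral>y. (x \<bullet> y) * phi x j y \<partial>sphere_measure)" by simp
  also have "\<dots> = (\<Sum>k\<in>UNIV - {i}. \<integral>y. (e k \<bullet> y)\<^sup>2 * ?q y \<partial>sphere_measure)"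
    unfolding phi_def using inner ei ne
    by (intro sum.cong refl integral_sphere_measure_rotation) (auto simp: x dest: sym)
  also have "\<dots> = (\<integral>y. (\<Sum>k\<in>UNIV - {i}. (e k \<bullet> y)\<^sup>2 * ?q y) \<partial>sphere_measure)"
    by (rule Bochner_Integration.integral_sum[symmetric])
      (intro integrable_sphere_measure_continuous continuous_intros; simp)
  also have "\<dots> = (\<integral>y. real j * ((1 - x \<bullet> y) * phi x j y) \<partial>sphere_measure)"
  proof (rule integral_cong_AE)
    show "AE y in sphere_measure. (\<Sum>k\<in>UNIV - {i}. (e k \<bullet> y)\<^sup>2 * ?q y) = real j * ((1 - x \<bullet> y) * phi x j y)"
      using AE_sphere_measure
    proof eventually_elim
      case (elim y)
      have "(\<Sum>k\<in>UNIV - {i}. (e k \<bullet> y)\<^sup>2) = 1 - (x \<bullet> y)\<^sup>2"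
        using sumsq[of y] elim ei by (subst sum_diff1) (auto simp: norm_eq_1)
      then have "(\<Sum>k\<in>UNIV - {i}. (e k \<bullet> y)\<^sup>2 * ?q y) = (1 - (x \<bullet> y)\<^sup>2) * ?q y"
        by (simp only: sum_distrib_right[symmetric])
      also have "\<dots> = real j * ((1 - x \<bullet> y) * (((x \<bullet> y + 1) / 2) * ((x \<bullet> y + 1) / 2) ^ (j - 1)))"
        by (simp add: power2_eq_square field_simps)
      also have "\<dots> = real j * ((1 - x \<bullet> y) * phi x j y)"
        using False by (cases j) (simp_all add: phi_def)
      finally show ?case .
    qed
  qed (auto cong: measurable_cong_sets simp: phi_def)
  finally show ?thesis by simp
qed


section \<open>Concentration of the kernel and size of its integral\<close>

lemma phi_nonneg: "\<bar>x \<bullet> y\<bar> \<le> 1 \<Longrightarrow> 0 \<le> phi x k y"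
  unfolding phi_def by (intro zero_le_power) auto

text \<open>Squared norms of the kernel become plain integrals of the kernel with exponent
  \<open>2 * k\<close>, to which the moment estimates apply directly.\<close>

lemma phi_square: "(phi x k y)\<^sup>2 = phi x (2 * k) y"
  unfolding phi_def power_mult[symmetric] by (simp only: mult.commute)

lemma abs_inner_sphere_le_1:
  assumes "norm x = 1" "y \<in> sphere 0 1"
  shows "\<bar>x \<bullet> y\<bar> \<le> 1"
  using Cauchy_Schwarz_ineq2[of x y] assms by simp

text \<open>Concentration of the kernel: under the weight \<open>phi x j\<close> the mean of
  \<open>1 - t\<close> is \<open>O(1 / j)\<close>. This is the moment identity with
  \<open>t \<le> 1\<close> inserted on its left-hand side and \<open>CARD('n) - 1\<close> relaxed to
  \<open>CARD('n)\<close>.\<close>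

lemma phi_first_moment_le:
  fixes x :: "real^'n"
  assumes x: "norm x = 1" and j: "j \<ge> 1"
  shows "(\<integral>y. (1 - x \<bullet> y) * phi x j y \<partial>sphere_measure)
       \<le> real (CARD('n)) / real j * (\<integral>y. phi x j y \<partial>sphere_measure)"
proof -
  have "(\<integral>y. (x \<bullet> y) * phi x j y \<partial>sphere_measure) \<le> (\<integral>y. phi x j y \<partial>sphere_measure)"
  proof (rule integral_mono_AE)
    show "AE y in sphere_measure. (x \<bullet> y) * phi x j y \<le> phi x j y"
      using AE_sphere_measure
    proof eventually_elim
      case (elim y)
      then have "\<bar>x \<bullet> y\<bar> \<le> 1" using x by (intro abs_inner_sphere_le_1)
      then show ?case using phi_nonneg[of x y j] mult_right_mono[of "x \<bullet> y" 1 "phi x j y"] by simp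
    qed
  qed (intro integrable_sphere_measure_continuous continuous_intros)+
  moreover have "(\<integral>y. phi x j y \<partial>sphere_measure) \<ge> 0"
    by (rule integral_nonneg_AE) (use AE_sphere_measure x in \<open>auto elim!: eventually_mono intro!: phi_nonneg abs_inner_sphere_le_1\<close>)
  ultimately have "real (CARD('n) - 1) * (\<integral>y. (x \<bullet> y) * phi x j y \<partial>sphere_measure)
     \<le> real CARD('n) * (\<integral>y. phi x j y \<partial>sphere_measure)"
    by (intro order.trans[OF mult_left_mono mult_right_mono]) auto
  then show ?thesis using phi_moment_identity[OF x, of j] j by (simp add: field_simps)
qed

text \<open>The ratio of consecutive integrals is at least \<open>j / (j + n - 1)\<close>, which Bernoulli's
  inequality compares with \<open>(j / (j + 1)) ^ (n - 1)\<close>.\<close>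
lemma phi_integral_lower_bound:
  fixes x :: "real^'n"
  assumes x: "norm x = 1"
  shows "(\<integral>y. phi x (Suc j) y \<partial>sphere_measure) \<ge> 1 / (2 * real (Suc j) ^ (CARD('n) - 1))"
proof -
  interpret prob_space "sphere_measure :: (real^'n) measure" by (rule prob_space_sphere_measure)
  define N where "N = CARD('n) - 1"
  have int: "integrable sphere_measure (phi x j)" "integrable sphere_measure (\<lambda>y. (x \<bullet> y) * phi x j y)" for j
    by (intro integrable_sphere_measure_continuous continuous_intros)+
  \<comment> \<open>Splitting off one factor \<open>(1 + t) / 2\<close> makes the next integral the
    mean of the two integrals that the moment identity relates.\<close>
  have suc: "(\<integral>y. phi x (Suc j) y \<partial>sphere_measure)
    = ((\<integral>y. (x \<bullet> y) * phi x j y \<partial>sphere_measure) + (\<integral>y. phi x j y \<partial>sphere_measure)) / 2" for j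
  proof -
    have "phi x (Suc j) y = ((x \<bullet> y) * phi x j y + phi x j y) / 2" for y
      by (simp add: phi_def algebra_simps add_divide_distrib)
    then have "(\<integral>y. phi x (Suc j) y \<partial>sphere_measure)
      = (\<integral>y. ((x \<bullet> y) * phi x j y + phi x j y) / 2 \<partial>sphere_measure)"
      by (intro Bochner_Integration.integral_cong refl)
    then show ?thesis using int[of j] by simp
  qed
  show ?thesis unfolding N_def[symmetric]
  proof (induction j)
    \<comment> \<open>The mean of \<open>t\<close> vanishes by symmetry, so the induction starts
      from the exact value \<open>1 / 2\<close>; this is the 2 in the bound.\<close>
    case 0
    have "(\<integral>y. x \<bullet> y \<partial>sphere_measure) = (\<integral>y. x \<bullet> (- y) \<partial>sphere_measure)"
      by (rule integral_sphere_measure_orthogonal[symmetric])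
        (auto simp: orthogonal_transformation linear_conv_bounded_linear bounded_linear_minus)
    moreover have "phi x 0 = (\<lambda>y. 1)" by (simp add: phi_def fun_eq_iff)
    ultimately show ?case unfolding suc[of 0] using prob_space by simp
  next
    case (Suc j)
    define J where "J = (\<integral>y. (x \<bullet> y) * phi x (Suc j) y \<partial>sphere_measure)"
    define I where "I = (\<integral>y. phi x (Suc j) y \<partial>sphere_measure)"
    have I0: "I \<ge> 0" using Suc unfolding I_def by (rule order.trans[rotated]) simp
    have "real N * J = real (Suc j) * (I - J)"
      using phi_moment_identity[OF x, of "Suc j"] int[of "Suc j"]
      unfolding N_def J_def I_def by (simp add: algebra_simps)
    \<comment> \<open>The ratio of \<open>J\<close> to \<open>I\<close> is at most 1, so the next
      integral, which is the mean of \<open>I\<close> and \<open>J\<close>, is at least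
      \<open>J\<close>.\<close>
    then have J: "J = real (Suc j) / real (N + Suc j) * I" by (simp add: field_simps)
    have bern: "1 + real N / real (Suc j) \<le> (1 + 1 / real (Suc j)) ^ N"
      using Bernoulli_inequality[of "1 / real (Suc j)" N] order.trans[of "-1" 0 "1 / real (Suc j)"]
      by simp
    have "1 / (2 * real (Suc (Suc j)) ^ N) = 1 / (1 + 1 / real (Suc j)) ^ N * (1 / (2 * real (Suc j) ^ N))"
    proof -
      have "1 + 1 / real (Suc j) = real (Suc (Suc j)) / real (Suc j)" by (simp add: field_simps)
      then show ?thesis by (simp only: power_divide) simp
    qed
    also have "\<dots> \<le> 1 / (1 + real N / real (Suc j)) * I"
      using bern Suc unfolding I_def[symmetric]
      by (intro mult_mono frac_le) (auto intro: add_pos_nonneg)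
    also have "\<dots> = J"
      unfolding J by (simp add: field_simps)
    also have "J \<le> (J + I) / 2"
    proof -
      have "real (Suc j) / real (N + Suc j) * I \<le> 1 * I" using I0 by (intro mult_right_mono) auto
      then show ?thesis unfolding J[symmetric] by simp
    qed
    also have "\<dots> = (\<integral>y. phi x (Suc (Suc j)) y \<partial>sphere_measure)"
      unfolding suc[of "Suc j"] J_def I_def ..
    finally show ?case .
  qed
qed

section \<open>Polynomials and least squares\<close>

lemma finite_multiindices: "finite {\<alpha> :: 'n::finite \<Rightarrow> nat. sum \<alpha> UNIV \<le> d}"
proof (rule finite_subset)
  show "{\<alpha> :: 'n \<Rightarrow> nat. sum \<alpha> UNIV \<le> d} \<subseteq> (UNIV :: 'n set) \<rightarrow>\<^sub>E {..d}"
    by (auto simp: PiE_def extensional_def) (meson finite member_le_sum UNIV_I order_trans zero_le)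
  show "finite ((UNIV :: 'n set) \<rightarrow>\<^sub>E {..d})" by (intro finite_PiE) auto
qed

lemma poly_le_continuous: "p \<in> poly_le d \<Longrightarrow> continuous_on A p"
  unfolding poly_le_def by (auto intro!: continuous_intros)

lemma monomial_in_poly_le:
  assumes "sum \<alpha> UNIV \<le> d"
  shows "(\<lambda>x::real^'n. a * (\<Prod>i\<in>UNIV. (x $ i) ^ \<alpha> i)) \<in> poly_le d"
  unfolding poly_le_def mem_Collect_eq
proof (intro exI ext)
  fix x :: "real^'n"
  show "a * (\<Prod>i\<in>UNIV. (x $ i) ^ \<alpha> i) =
    (\<Sum>\<beta>\<in>{\<beta>. sum \<beta> UNIV \<le> d}. (if \<beta> = \<alpha> then a else 0) * (\<Prod>i\<in>UNIV. (x $ i) ^ \<beta> i))"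
    using assms by (simp add: if_distrib[of "\<lambda>c. c * _"] finite_multiindices cong: if_cong)
qed

lemma poly_le_add:
  assumes "p \<in> poly_le d" "q \<in> poly_le d"
  shows "(\<lambda>x. p x + q x) \<in> poly_le d"
proof -
  obtain a b where "p = (\<lambda>x. \<Sum>\<alpha>\<in>{\<alpha>. sum \<alpha> UNIV \<le> d}. a \<alpha> * (\<Prod>i\<in>UNIV. (x $ i) ^ \<alpha> i))"
    "q = (\<lambda>x. \<Sum>\<alpha>\<in>{\<alpha>. sum \<alpha> UNIV \<le> d}. b \<alpha> * (\<Prod>i\<in>UNIV. (x $ i) ^ \<alpha> i))"
    using assms unfolding poly_le_def by blast
  then show ?thesis unfolding poly_le_def
    by (auto intro!: exI[of _ "\<lambda>\<alpha>. a \<alpha> + b \<alpha>"] simp: algebra_simps sum.distrib)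
qed

lemma poly_le_cmult:
  assumes "p \<in> poly_le d"
  shows "(\<lambda>x. c * p x) \<in> poly_le d"
proof -
  obtain a where "p = (\<lambda>x. \<Sum>\<alpha>\<in>{\<alpha>. sum \<alpha> UNIV \<le> d}. a \<alpha> * (\<Prod>i\<in>UNIV. (x $ i) ^ \<alpha> i))"
    using assms unfolding poly_le_def by blast
  then show ?thesis unfolding poly_le_def
    by (auto intro!: exI[of _ "\<lambda>\<alpha>. c * a \<alpha>"] simp: algebra_simps sum_distrib_left)
qed

lemma poly_le_const: "(\<lambda>x. c) \<in> poly_le d"
  using monomial_in_poly_le[of "\<lambda>_. 0" d c] by simp

lemma poly_le_sum:
  assumes "\<And>i. i \<in> I \<Longrightarrow> p i \<in> poly_le d"
  shows "(\<lambda>x. \<Sum>i\<in>I. p i x) \<in> poly_le d"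
  using assms by (induction I rule: infinite_finite_induct) (auto intro: poly_le_add poly_le_const)

lemma poly_le_mult_coordinate:
  fixes p :: "real^'n \<Rightarrow> real"
  assumes "p \<in> poly_le d"
  shows "(\<lambda>x. x $ i * p x) \<in> poly_le (Suc d)"
proof -
  obtain a where p: "p = (\<lambda>x. \<Sum>\<alpha>\<in>{\<alpha>. sum \<alpha> UNIV \<le> d}. a \<alpha> * (\<Prod>i\<in>UNIV. (x $ i) ^ \<alpha> i))"
    using assms unfolding poly_le_def by blast
  have shift: "x $ i * (a \<alpha> * (\<Prod>l\<in>UNIV. (x $ l) ^ \<alpha> l)) = a \<alpha> * (\<Prod>l\<in>UNIV. (x $ l) ^ (\<alpha>(i := Suc (\<alpha> i))) l)" for x :: "real^'n" and \<alpha>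
    by (simp add: prod.remove[of UNIV i])
  have "(\<lambda>x. \<Sum>\<alpha>\<in>{\<alpha>. sum \<alpha> UNIV \<le> d}. a \<alpha> * (\<Prod>l\<in>UNIV. (x $ l) ^ (\<alpha>(i := Suc (\<alpha> i))) l)) \<in> poly_le (Suc d)"
  proof (intro poly_le_sum monomial_in_poly_le)
    fix \<alpha> :: "'n \<Rightarrow> nat" assume "\<alpha> \<in> {\<alpha>. sum \<alpha> UNIV \<le> d}"
    then show "sum (\<alpha>(i := Suc (\<alpha> i))) UNIV \<le> Suc d"
      by (simp add: sum.remove[of UNIV i])
  qed
  then show ?thesis unfolding p sum_distrib_left shift .
qed

lemma poly_le_mult_inner:
  assumes "p \<in> poly_le d"
  shows "(\<lambda>y. (x \<bullet> y) * p y) \<in> poly_le (Suc d)"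
proof -
  have "(\<lambda>y. \<Sum>i\<in>UNIV. x $ i * (y $ i * p y)) \<in> poly_le (Suc d)"
    by (intro poly_le_sum poly_le_cmult poly_le_mult_coordinate assms)
  then show ?thesis by (simp add: inner_vec_def sum_distrib_right mult.assoc)
qed

lemma poly_le_Suc: "p \<in> poly_le d \<Longrightarrow> p \<in> poly_le (Suc d)"
proof -
  assume "p \<in> poly_le d"
  then obtain a where "p = (\<lambda>x. \<Sum>\<alpha>\<in>{\<alpha>. sum \<alpha> UNIV \<le> d}. a \<alpha> * (\<Prod>i\<in>UNIV. (x $ i) ^ \<alpha> i))"
    unfolding poly_le_def by blast
  then show ?thesis by (auto intro!: poly_le_sum monomial_in_poly_le)
qed

lemma poly_le_mono:
  assumes "p \<in> poly_le d" "d \<le> e"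
  shows "p \<in> poly_le e"
  using assms(2,1) by (induction e rule: dec_induct) (auto intro: poly_le_Suc)

text \<open>Gram-Schmidt by induction on \<open>A\<close>, with the induction hypothesis applied
  both to \<open>h\<close> and to the new function \<open>\<phi> k\<close>. Monomials become
  linearly dependent on the sphere from degree 2 on, so the argument has to cope with a residual
  \<open>r\<close> that vanishes almost everywhere.\<close>

lemma least_squares_exists:
  fixes \<phi> :: "'i \<Rightarrow> 'a \<Rightarrow> real" and V :: "('a \<Rightarrow> real) set"
  assumes add: "\<And>u v c. u \<in> V \<Longrightarrow> v \<in> V \<Longrightarrow> (\<lambda>x. u x + c * v x) \<in> V"
    and int: "\<And>u v. u \<in> V \<Longrightarrow> v \<in> V \<Longrightarrow> integrable M (\<lambda>x. u x * v x)"
    and "finite A" "\<And>i. i \<in> A \<Longrightarrow> \<phi> i \<in> V" "h \<in> V"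
  shows "\<exists>c. (\<lambda>x. h x - (\<Sum>i\<in>A. c i * \<phi> i x)) \<in> V \<and>
     (\<forall>j\<in>A. (\<integral>x. (h x - (\<Sum>i\<in>A. c i * \<phi> i x)) * \<phi> j x \<partial>M) = 0)"
  using assms(3-5)
proof (induction A arbitrary: h rule: finite_induct)
  case empty
  then show ?case by simp
next
  case (insert k A)
  obtain a where a: "(\<lambda>x. \<phi> k x - (\<Sum>i\<in>A. a i * \<phi> i x)) \<in> V"
     "\<And>j. j \<in> A \<Longrightarrow> (\<integral>x. (\<phi> k x - (\<Sum>i\<in>A. a i * \<phi> i x)) * \<phi> j x \<partial>M) = 0"
    using insert.IH[of "\<phi> k"] insert.prems by auto
  obtain b where b: "(\<lambda>x. h x - (\<Sum>i\<in>A. b i * \<phi> i x)) \<in> V"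
     "\<And>j. j \<in> A \<Longrightarrow> (\<integral>x. (h x - (\<Sum>i\<in>A. b i * \<phi> i x)) * \<phi> j x \<partial>M) = 0"
    using insert.IH[of h] insert.prems by auto
  define r where "r x = \<phi> k x - (\<Sum>i\<in>A. a i * \<phi> i x)" for x
  define s where "s x = h x - (\<Sum>i\<in>A. b i * \<phi> i x)" for x
  have rV: "r \<in> V" and sV: "s \<in> V" using a b by (simp_all add: r_def[abs_def] s_def[abs_def])
  have r0: "(\<integral>x. r x * \<phi> j x \<partial>M) = 0" and s0: "(\<integral>x. s x * \<phi> j x \<partial>M) = 0" if "j \<in> A" for j
    using that a b by (simp_all add: r_def s_def)
  have \<phi>V: "\<phi> j \<in> V" if "j \<in> insert k A" for j using insert.prems that by auto
  \<comment> \<open>The coefficient that makes \<open>s - t * r\<close> orthogonal to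
    \<open>r\<close>; if \<open>r\<close> has norm zero, division by zero gives
    \<open>t = 0\<close>.\<close>
  define t where "t = (\<integral>x. s x * r x \<partial>M) / (\<integral>x. r x * r x \<partial>M)"
  define w where "w x = s x + (- t) * r x" for x
  have wV: "w \<in> V" unfolding w_def by (intro add rV sV)
  have w0: "(\<integral>x. w x * \<phi> j x \<partial>M) = 0" if "j \<in> A" for j
  proof -
    have "(\<integral>x. w x * \<phi> j x \<partial>M) = (\<integral>x. s x * \<phi> j x - t * (r x * \<phi> j x) \<partial>M)"
      by (intro Bochner_Integration.integral_cong) (auto simp: w_def algebra_simps)
    also have "\<dots> = 0"
      using that int[OF rV \<phi>V] int[OF sV \<phi>V] r0 s0 by simp
    finally show ?thesis .
  qed
  have wr: "(\<integral>x. w x * r x \<partial>M) = 0"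
  proof -
    have "(\<integral>x. w x * r x \<partial>M) = (\<integral>x. s x * r x - t * (r x * r x) \<partial>M)"
      by (intro Bochner_Integration.integral_cong) (auto simp: w_def algebra_simps)
    also have "\<dots> = (\<integral>x. s x * r x \<partial>M) - t * (\<integral>x. r x * r x \<partial>M)"
      using int[OF rV rV] int[OF sV rV] by simp
    also have "\<dots> = 0"
    proof (cases "(\<integral>x. r x * r x \<partial>M) = 0")
      \<comment> \<open>In the degenerate case \<open>r\<close> is zero almost everywhere, so
        \<open>s * r\<close> integrates to zero as well.\<close>
      case True
      then have "AE x in M. r x * r x = 0"
        using integral_nonneg_eq_0_iff_AE[OF int[OF rV rV]] by auto
      then have "AE x in M. s x * r x = 0" by eventually_elim auto
      then have "(\<integral>x. s x * r x \<partial>M) = 0" by (rule integral_eq_zero_AE)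
      with True show ?thesis by simp
    qed (simp add: t_def)
    finally show ?thesis .
  qed
  have wk: "(\<integral>x. w x * \<phi> k x \<partial>M) = 0"
  proof -
    \<comment> \<open>\<open>\<phi> k\<close> is \<open>r\<close> plus a combination of the earlier
      functions, and \<open>w\<close> is orthogonal to all of these.\<close>
    have "(\<integral>x. w x * \<phi> k x \<partial>M) = (\<integral>x. w x * r x + (\<Sum>i\<in>A. a i * (w x * \<phi> i x)) \<partial>M)"
      by (intro Bochner_Integration.integral_cong) (auto simp: r_def algebra_simps sum_distrib_left)
    also have "\<dots> = 0"
      using int[OF wV \<phi>V] int[OF wV rV] w0 wr by (simp add: Bochner_Integration.integral_sum)
    finally show ?thesis .
  qed
  \<comment> \<open>Read off from \<open>w = s - t * r\<close> by expanding both residuals.\<close>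
  define c where "c i = (if i = k then t else b i - t * a i)" for i
  have "w x = h x - (\<Sum>i\<in>insert k A. c i * \<phi> i x)" for x
  proof -
    have "(\<Sum>i\<in>A. c i * \<phi> i x) = (\<Sum>i\<in>A. b i * \<phi> i x) - t * (\<Sum>i\<in>A. a i * \<phi> i x)"
      unfolding sum_distrib_left sum_subtractf[symmetric]
      using insert.hyps by (intro sum.cong) (auto simp: c_def algebra_simps)
    then show ?thesis
      using insert.hyps by (simp add: w_def s_def r_def c_def algebra_simps)
  qed
  then have "w = (\<lambda>x. h x - (\<Sum>i\<in>insert k A. c i * \<phi> i x))" by auto
  then show ?case using w0 wk wV by (intro exI[of _ c]) auto
qed

section \<open>Chebyshev truncation of the kernel\<close>

text \<open>The two power series compare term by term, because
  \<open>2 ^ n * fact n \<le> fact (2 * n)\<close>; the odd terms of the series for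
  \<open>cosh\<close> are zero and are removed by reindexing.\<close>

lemma cosh_le_exp_half_square: "cosh x \<le> exp (x\<^sup>2 / 2)" for x :: real
proof -
  have c: "(\<lambda>n. if even n then x ^ n / fact n else 0) sums cosh x"
    using cosh_converges[of x] by (simp add: scaleR_conv_of_real divide_inverse mult.commute cong: if_cong)
  then have c': "(\<lambda>n. x ^ (2 * n) / fact (2 * n)) sums cosh x"
  proof -
    define g where "g n = (if even n then x ^ n / fact n else 0)" for n
    have "(\<lambda>n. g (2 * n)) sums cosh x \<longleftrightarrow> g sums cosh x"
      by (rule sums_mono_reindex) (auto simp: strict_mono_def g_def elim!: evenE)
    then show ?thesis using c by (simp add: g_def[abs_def])
  qed
  have e: "(\<lambda>n. (x\<^sup>2 / 2) ^ n / fact n) sums exp (x\<^sup>2 / 2)"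
    using exp_converges[of "x\<^sup>2 / 2"] by (simp only: real_scaleR_def divide_inverse_commute)
  have f: "(2::real) ^ n * fact n \<le> fact (2 * n)" for n
  proof (induction n)
    case (Suc n)
    have "(2::real) ^ Suc n * fact (Suc n) = (2 * (real n + 1)) * (2 ^ n * fact n)" by simp
    also have "\<dots> \<le> ((2 * real n + 2) * (2 * real n + 1)) * fact (2 * n)"
      using Suc by (intro mult_mono) (auto simp: algebra_simps)
    also have "\<dots> = fact (2 * Suc n)" by (simp add: algebra_simps)
    finally show ?case .
  qed simp
  show ?thesis
  proof (rule sums_le[OF _ c' e])
    fix n
    have "x ^ (2 * n) / fact (2 * n) \<le> x ^ (2 * n) / (2 ^ n * fact n)"
      using f by (intro divide_left_mono) auto
    then show "x ^ (2 * n) / fact (2 * n) \<le> (x\<^sup>2 / 2) ^ n / fact n"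
      by (simp add: power_mult power_divide)
  qed
qed

text \<open>The left-hand side is \<open>cos (\<theta> / 2) ^ (2 * k)\<close>; expand \<open>(cis (- \<theta> / 2) + cis (\<theta> / 2)) ^ (2 * k)\<close>.\<close>
lemma half_cos_power_expansion:
  "((cos \<theta> + 1) / 2) ^ k = (\<Sum>i\<le>2 * k. real ((2 * k) choose i) / 4 ^ k * cos ((real k - real i) * \<theta>))"
proof -
  have "complex_of_real (2 * cos (\<theta> / 2)) = cis (- \<theta> / 2) + cis (\<theta> / 2)"
    by (simp add: complex_eq_iff)
  then have "complex_of_real ((2 * cos (\<theta> / 2)) ^ (2 * k)) = (cis (- \<theta> / 2) + cis (\<theta> / 2)) ^ (2 * k)"
    by (simp only: of_real_power)
  also have "\<dots> = (\<Sum>i\<le>2 * k. of_nat ((2 * k) choose i) * cis (- \<theta> / 2) ^ i * cis (\<theta> / 2) ^ (2 * k - i))"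
    by (rule binomial_ring)
  also have "\<dots> = (\<Sum>i\<le>2 * k. of_nat ((2 * k) choose i) * cis ((real k - real i) * \<theta>))"
  proof (intro sum.cong refl)
    fix i assume "i \<in> {..2 * k}"
    then have "real i * (- \<theta> / 2) + real (2 * k - i) * (\<theta> / 2) = (real k - real i) * \<theta>"
      by (simp add: of_nat_diff field_simps)
    then have "cis (- \<theta> / 2) ^ i * cis (\<theta> / 2) ^ (2 * k - i) = cis ((real k - real i) * \<theta>)"
      by (simp only: Complex.DeMoivre cis_mult)
    then show "of_nat ((2 * k) choose i) * cis (- \<theta> / 2) ^ i * cis (\<theta> / 2) ^ (2 * k - i)
        = of_nat ((2 * k) choose i) * cis ((real k - real i) * \<theta>)"
      by (simp only: mult.assoc)
  qed
  finally have "(2 * cos (\<theta> / 2)) ^ (2 * k) = Re (\<Sum>i\<le>2 * k. of_nat ((2 * k) choose i) * cis ((real k - real i) * \<theta>))"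
    by (metis Re_complex_of_real)
  also have "\<dots> = (\<Sum>i\<le>2 * k. real ((2 * k) choose i) * cos ((real k - real i) * \<theta>))"
    by (simp add: Re_sum)
  finally have "(2 * cos (\<theta> / 2)) ^ (2 * k) / 4 ^ k = (\<Sum>i\<le>2 * k. real ((2 * k) choose i) / 4 ^ k * cos ((real k - real i) * \<theta>))"
    by (simp add: sum_divide_distrib)
  moreover have "(2 * cos (\<theta> / 2)) ^ (2 * k) / 4 ^ k = ((cos \<theta> + 1) / 2) ^ k"
    using cos_double_cos[of "\<theta> / 2"] by (simp add: power_mult power_mult_distrib power_divide)
  ultimately show ?thesis by simp
qed

text \<open>Chernoff's bound for a centred binomial variable with \<open>2 * k\<close> fair trials.
  Its moment generating function is \<open>cosh (t / 2) ^ (2 * k)\<close>, at most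
  \<open>exp (k * t ^ 2 / 4)\<close>.\<close>

lemma central_binomial_tail:
  assumes k: "k \<ge> 1"
  shows "(\<Sum>i\<in>{i. i \<le> 2 * k \<and> real d < \<bar>real k - real i\<bar>}. real ((2 * k) choose i) / 4 ^ k)
       \<le> 2 * exp (- (real d)\<^sup>2 / real k)"
proof -
  \<comment> \<open>The minimiser of the exponent \<open>- \<mu> * d + k * \<mu> ^ 2 / 4\<close>,
    with minimum \<open>- d ^ 2 / k\<close>.\<close>
  define \<mu> where "\<mu> = 2 * real d / real k"
  have \<mu>: "\<mu> \<ge> 0" by (simp add: \<mu>_def)
  have gen: "(\<Sum>i\<le>2 * k. real ((2 * k) choose i) / 4 ^ k * exp (t * (real k - real i))) \<le> exp (real k * t\<^sup>2 / 4)" for t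
  proof -
    have "(\<Sum>i\<le>2 * k. real ((2 * k) choose i) / 4 ^ k * exp (t * (real k - real i)))
       = (\<Sum>i\<le>2 * k. real ((2 * k) choose i) * exp (- t / 2) ^ i * exp (t / 2) ^ (2 * k - i)) / 4 ^ k"
      unfolding sum_divide_distrib
      by (intro sum.cong refl) (auto simp: exp_of_nat_mult[symmetric] of_nat_diff exp_add[symmetric] algebra_simps)
    also have "\<dots> = (exp (- t / 2) + exp (t / 2)) ^ (2 * k) / 4 ^ k"
      by (simp add: binomial_ring)
    also have "\<dots> = cosh (t / 2) ^ (2 * k)"
      by (simp add: cosh_field_def power_divide power_mult add.commute)
    also have "\<dots> \<le> exp ((t / 2)\<^sup>2 / 2) ^ (2 * k)"
      by (intro power_mono cosh_le_exp_half_square) auto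
    also have "\<dots> = exp (real k * t\<^sup>2 / 4)"
      by (simp add: exp_of_nat_mult[symmetric] power_divide)
    finally show ?thesis .
  qed
  have "(\<Sum>i\<in>{i. i \<le> 2 * k \<and> real d < \<bar>real k - real i\<bar>}. real ((2 * k) choose i) / 4 ^ k)
     \<le> (\<Sum>i\<in>{i. i \<le> 2 * k \<and> real d < \<bar>real k - real i\<bar>}. exp (- \<mu> * real d) *
        (real ((2 * k) choose i) / 4 ^ k * exp (\<mu> * (real k - real i)) + real ((2 * k) choose i) / 4 ^ k * exp ((- \<mu>) * (real k - real i))))"
  proof (rule sum_mono)
    fix i assume "i \<in> {i. i \<le> 2 * k \<and> real d < \<bar>real k - real i\<bar>}"
    then have "\<mu> * real d \<le> \<mu> * \<bar>real k - real i\<bar>" using \<mu> by (intro mult_left_mono) auto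
    then have "exp (\<mu> * real d) \<le> exp (\<mu> * \<bar>real k - real i\<bar>)" by simp
    \<comment> \<open>Both tails are treated at once by bounding \<open>exp\<close> of the absolute
      value by the two exponentials together; this gives the factor 2.\<close>
    also have "\<dots> \<le> exp (\<mu> * (real k - real i)) + exp ((- \<mu>) * (real k - real i))"
      by (cases "real k - real i \<ge> 0") (auto simp: abs_if algebra_simps)
    finally have "1 \<le> exp (- \<mu> * real d) * (exp (\<mu> * (real k - real i)) + exp ((- \<mu>) * (real k - real i)))"
      by (simp add: exp_minus field_simps)
    then have "real ((2 * k) choose i) / 4 ^ k * 1 \<le> real ((2 * k) choose i) / 4 ^ k * (exp (- \<mu> * real d) * (exp (\<mu> * (real k - real i)) + exp ((- \<mu>) * (real k - real i))))"
      by (intro mult_left_mono) auto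
    then show "real ((2 * k) choose i) / 4 ^ k \<le> exp (- \<mu> * real d) *
        (real ((2 * k) choose i) / 4 ^ k * exp (\<mu> * (real k - real i)) + real ((2 * k) choose i) / 4 ^ k * exp ((- \<mu>) * (real k - real i)))"
      by (simp only: ring_distribs mult_1_right mult.assoc mult.left_commute)
  qed
  also have "\<dots> \<le> (\<Sum>i\<le>2 * k. exp (- \<mu> * real d) *
        (real ((2 * k) choose i) / 4 ^ k * exp (\<mu> * (real k - real i)) + real ((2 * k) choose i) / 4 ^ k * exp ((- \<mu>) * (real k - real i))))"
    by (intro sum_mono2) auto
  also have "\<dots> = exp (- \<mu> * real d) * ((\<Sum>i\<le>2 * k. real ((2 * k) choose i) / 4 ^ k * exp (\<mu> * (real k - real i)))
      + (\<Sum>i\<le>2 * k. real ((2 * k) choose i) / 4 ^ k * exp ((- \<mu>) * (real k - real i))))"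
    by (simp only: sum_distrib_left sum.distrib ring_distribs)
  also have "\<dots> \<le> exp (- \<mu> * real d) * (exp (real k * \<mu>\<^sup>2 / 4) + exp (real k * (- \<mu>)\<^sup>2 / 4))"
    by (intro mult_left_mono add_mono gen) auto
  also have "\<dots> = 2 * exp (- \<mu> * real d + real k * \<mu>\<^sup>2 / 4)"
    by (simp only: exp_add power2_minus) simp
  also have "- \<mu> * real d + real k * \<mu>\<^sup>2 / 4 = - (real d)\<^sup>2 / real k"
    using k by (simp add: \<mu>_def power2_eq_square field_simps)
  finally show ?thesis .
qed

text \<open>Chebyshev polynomials of the first kind. The product is bracketed as
  \<open>2 * (t * _)\<close> so that the closure lemmas for \<open>poly_le\<close> fit the
  recurrence as it stands.\<close>

fun chebyshev :: "nat \<Rightarrow> real \<Rightarrow> real" where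
  "chebyshev 0 t = 1"
| "chebyshev (Suc 0) t = t"
| "chebyshev (Suc (Suc n)) t = 2 * (t * chebyshev (Suc n) t) - chebyshev n t"

lemma chebyshev_cos: "chebyshev n (cos \<theta>) = cos (real n * \<theta>)"
proof (induction n rule: induct_nat_012)
  case (ge2 n)
  have "cos (real (Suc (Suc n)) * \<theta>) + cos (real n * \<theta>) = 2 * (cos \<theta> * cos (real (Suc n) * \<theta>))"
    using cos_plus_cos[of "real (Suc (Suc n)) * \<theta>" "real n * \<theta>"] by (simp add: algebra_simps add_divide_distrib)
  with ge2 show ?case by simp
qed auto

lemma chebyshev_in_poly_le: "(\<lambda>y::real^'n. chebyshev n (x \<bullet> y)) \<in> poly_le n"
proof (induction n rule: induct_nat_012)
  case 0
  then show ?case by (simp add: poly_le_const)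
next
  case 1
  then show ?case using poly_le_mult_inner[OF poly_le_const[of 1 0], of x] by simp
next
  case (ge2 n)
  have "(\<lambda>y. 2 * ((x \<bullet> y) * chebyshev (Suc n) (x \<bullet> y)) + (-1) * chebyshev n (x \<bullet> y)) \<in> poly_le (Suc (Suc n))"
    by (intro poly_le_add poly_le_cmult poly_le_mult_inner ge2 poly_le_mono[OF ge2(1)]) auto
  then show ?case by simp
qed

text \<open>With \<open>x \<bullet> y = cos \<theta>\<close>, a cosine of frequency at most
  \<open>d\<close> is a Chebyshev polynomial in \<open>x \<bullet> y\<close>, hence a polynomial in
  \<open>y\<close> of degree at most \<open>d\<close>. Keeping these terms of the binomial cosine
  expansion leaves an error bounded by the sum of the discarded coefficients.\<close>

lemma phi_approximation:
  fixes x :: "real^'n"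
  assumes k: "k \<ge> 1"
  shows "\<exists>Q\<in>poly_le d. \<forall>y. \<bar>x \<bullet> y\<bar> \<le> 1 \<longrightarrow> \<bar>phi x k y - Q y\<bar> \<le> 2 * exp (- (real d)\<^sup>2 / real k)"
proof -
  define a where "a i = real ((2 * k) choose i) / 4 ^ k" for i
  define G where "G = {i. i \<le> 2 * k \<and> \<bar>real k - real i\<bar> \<le> real d}"
  define B where "B = {i. i \<le> 2 * k \<and> real d < \<bar>real k - real i\<bar>}"
  \<comment> \<open>The frequency as a natural number; its sign is irrelevant since the cosine is
    even.\<close>
  define m where "m i = nat \<bar>int k - int i\<bar>" for i
  have m: "real (m i) = \<bar>real k - real i\<bar>" for i by (simp add: m_def)
  define Q where "Q y = (\<Sum>i\<in>G. a i * chebyshev (m i) (x \<bullet> y))" for y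
  have "Q \<in> poly_le d" unfolding Q_def
  proof (intro poly_le_sum poly_le_cmult)
    fix i assume "i \<in> G"
    then have "real (m i) \<le> real d" by (simp add: G_def m)
    then show "(\<lambda>y. chebyshev (m i) (x \<bullet> y)) \<in> poly_le d"
      by (intro poly_le_mono[OF chebyshev_in_poly_le]) simp
  qed
  moreover have "\<bar>phi x k y - Q y\<bar> \<le> 2 * exp (- (real d)\<^sup>2 / real k)" if "\<bar>x \<bullet> y\<bar> \<le> 1" for y
  proof -
    define \<theta> where "\<theta> = arccos (x \<bullet> y)"
    have \<theta>: "x \<bullet> y = cos \<theta>" using that by (simp add: \<theta>_def cos_arccos_abs)
    have ch: "chebyshev (m i) (x \<bullet> y) = cos ((real k - real i) * \<theta>)" for i
      unfolding \<theta> chebyshev_cos m by (cases "real k - real i \<ge> 0") (auto simp: abs_if minus_mult_left[symmetric] simp del: minus_diff_eq)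
    have "phi x k y = (\<Sum>i\<in>G \<union> B. a i * cos ((real k - real i) * \<theta>))"
      unfolding phi_def \<theta> half_cos_power_expansion a_def
      by (intro sum.cong) (auto simp: G_def B_def)
    also have "\<dots> = Q y + (\<Sum>i\<in>B. a i * cos ((real k - real i) * \<theta>))"
      unfolding Q_def ch by (rule sum.union_disjoint) (auto simp: G_def B_def)
    finally have "\<bar>phi x k y - Q y\<bar> = \<bar>\<Sum>i\<in>B. a i * cos ((real k - real i) * \<theta>)\<bar>" by simp
    also have "\<dots> \<le> (\<Sum>i\<in>B. a i)"
      by (intro order.trans[OF sum_abs] sum_mono) (auto simp: abs_mult a_def intro!: mult_left_le divide_right_mono)
    also have "\<dots> \<le> 2 * exp (- (real d)\<^sup>2 / real k)"
      using central_binomial_tail[OF k, of d] unfolding a_def B_def .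
    finally show ?thesis .
  qed
  ultimately show ?thesis by blast
qed

section \<open>Great circles\<close>

text \<open>Taylor expansion to order four gives
  \<open>1 - cos \<theta> \<ge> \<theta> ^ 2 / 2 - \<theta> ^ 4 / 24\<close>. With
  \<open>\<theta> \<le> 3.2\<close> the right-hand side is at least
  \<open>11 / 150 * \<theta> ^ 2\<close>, which exceeds \<open>\<theta> ^ 2 / 16\<close> when
  \<theta> is nonzero.\<close>

lemma square_le_one_minus_cos:
  assumes "0 \<le> \<theta>" "\<theta> \<le> pi"
  shows "\<theta>\<^sup>2 \<le> 16 * (1 - cos \<theta>)"
proof -
  have "\<exists>t. cos \<theta> = (\<Sum>m<4. cos_coeff m * \<theta> ^ m) + (cos (t + 1/2 * real 4 * pi) / fact 4) * \<theta> ^ 4"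
    using Maclaurin_cos_expansion[of \<theta> 4] by blast
  then obtain t where "cos \<theta> = 1 - \<theta>\<^sup>2 / 2 + cos (t + 2 * pi) / 24 * \<theta> ^ 4"
    by (auto simp: lessThan_nat_numeral cos_coeff_def fact_numeral algebra_simps)
  moreover have "cos (t + 2 * pi) / 24 * \<theta> ^ 4 \<le> 1 / 24 * \<theta> ^ 4"
    by (intro mult_right_mono) auto
  moreover have "\<theta> ^ 4 \<le> 256/25 * \<theta>\<^sup>2"
  proof -
    have "\<theta> \<le> 3.2" using assms pi_less_4 pi_approx by simp
    then have "\<theta>\<^sup>2 \<le> 3.2\<^sup>2" using assms by (intro power_mono) auto
    then have "\<theta>\<^sup>2 * \<theta>\<^sup>2 \<le> 256/25 * \<theta>\<^sup>2" by (intro mult_right_mono) (auto simp: power2_eq_square)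
    then show ?thesis by (simp flip: power_add)
  qed
  moreover have "\<theta>\<^sup>2 \<ge> 0" by simp
  ultimately obtain a b where "cos \<theta> = 1 - a / 2 + b" "b \<le> 1 / 24 * (256 / 25 * a)" "a \<ge> 0" "a = \<theta>\<^sup>2"
    by (intro that[of "\<theta>\<^sup>2" "cos (t + 2 * pi) / 24 * \<theta> ^ 4"]) auto
  then have "a \<le> 16 * (1 - cos \<theta>)" by argo
  with \<open>a = \<theta>\<^sup>2\<close> show ?thesis by simp
qed

text \<open>Polar coordinates centred at \<open>x\<close>: the direction \<open>v\<close> is the
  normalised component of \<open>y\<close> orthogonal to \<open>x\<close>. At the two poles this
  component is zero and gives no direction.\<close>

lemma great_circle_coordinates:
  fixes x y :: "'a::real_inner"
  assumes x: "norm x = 1" and y: "norm y = 1" and "y \<noteq> x" "y \<noteq> - x"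
  obtains v \<theta> where "norm v = 1" "x \<bullet> v = 0" "0 \<le> \<theta>" "\<theta> \<le> pi" "x \<bullet> y = cos \<theta>"
    "y = cos \<theta> *\<^sub>R x + sin \<theta> *\<^sub>R v"
proof -
  define \<theta> where "\<theta> = arccos (x \<bullet> y)"
  have le: "\<bar>x \<bullet> y\<bar> \<le> 1" using Cauchy_Schwarz_ineq2[of x y] x y by simp
  have \<theta>: "0 \<le> \<theta>" "\<theta> \<le> pi" "x \<bullet> y = cos \<theta>"
    using le by (auto simp: \<theta>_def abs_le_iff intro!: arccos_lbound arccos_ubound cos_arccos_abs[symmetric])
  have xx: "x \<bullet> x = 1" "y \<bullet> y = 1" using x y by (simp_all add: norm_eq_1)
  define w where "w = y - cos \<theta> *\<^sub>R x"
  have ww: "w \<bullet> w = (sin \<theta>)\<^sup>2"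
  proof -
    have "w \<bullet> w = 1 - (cos \<theta>)\<^sup>2"
      using xx \<theta>(3) by (simp add: w_def inner_simps inner_commute power2_eq_square)
    then show ?thesis by (simp add: sin_squared_eq)
  qed
  have s0: "sin \<theta> \<ge> 0" using \<theta> by (simp add: sin_ge_zero)
  \<comment> \<open>Otherwise \<open>w = 0\<close>, and \<open>y\<close> would be one of the two
    poles.\<close>
  have "sin \<theta> \<noteq> 0"
  proof
    assume s: "sin \<theta> = 0"
    then have "y = cos \<theta> *\<^sub>R x" using ww by (simp add: w_def)
    moreover have "cos \<theta> = 1 \<or> cos \<theta> = -1"
      using s sin_cos_squared_add[of \<theta>] by (simp add: power2_eq_1_iff)
    ultimately show False using assms by auto
  qed
  with s0 have s: "sin \<theta> > 0" by simp
  define v where "v = w /\<^sub>R sin \<theta>"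
  have nw: "norm w = sin \<theta>" using ww s0 by (simp add: norm_eq_sqrt_inner)
  have "norm v = 1" using nw s by (simp add: v_def)
  moreover have "x \<bullet> v = 0" using xx \<theta>(3) by (simp add: v_def w_def inner_simps)
  moreover have "y = cos \<theta> *\<^sub>R x + sin \<theta> *\<^sub>R v" using s by (simp add: v_def w_def)
  ultimately show ?thesis using that \<theta> by blast
qed

lemma norm_great_circle:
  fixes x v :: "'a::real_inner"
  assumes "norm x = 1" "norm v = 1" "x \<bullet> v = 0"
  shows "norm (cos t *\<^sub>R x + sin t *\<^sub>R v) = 1" "norm (cos t *\<^sub>R v - sin t *\<^sub>R x) = 1"
proof -
  have "x \<bullet> x = 1" "v \<bullet> v = 1" "v \<bullet> x = 0" using assms by (simp_all add: norm_eq_1 inner_commute)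
  then show "norm (cos t *\<^sub>R x + sin t *\<^sub>R v) = 1" "norm (cos t *\<^sub>R v - sin t *\<^sub>R x) = 1"
    using assms(3) sin_cos_squared_add[of t]
    by (simp_all add: norm_eq_1 inner_simps power2_eq_square)
qed

text \<open>Chain rule along a unit-speed great circle, which avoids the excluded origin. The
  codomain is a general normed space so that the rule also applies to the operator-valued derivative
  in the second-order case.\<close>

lemma C1_great_circle_derivative:
  fixes F :: "'a::real_inner \<Rightarrow> 'b::real_normed_vector"
  assumes F: "C1_on (- {0}) F F'" and xv: "norm x = 1" "norm v = 1" "x \<bullet> v = 0"
  shows "((\<lambda>t. F (cos t *\<^sub>R x + sin t *\<^sub>R v)) has_vector_derivative
     F' (cos t *\<^sub>R x + sin t *\<^sub>R v) (cos t *\<^sub>R v - sin t *\<^sub>R x)) (at t)"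
proof -
  have ne: "cos t *\<^sub>R x + sin t *\<^sub>R v \<in> - {0}"
    using norm_great_circle[OF xv, of t] by auto
  have g: "((\<lambda>t. cos t *\<^sub>R x + sin t *\<^sub>R v) has_vector_derivative (cos t *\<^sub>R v - sin t *\<^sub>R x)) (at t)"
    by (auto intro!: derivative_eq_intros simp: has_real_derivative_iff_has_vector_derivative[symmetric])
  have "(F has_derivative F' (cos t *\<^sub>R x + sin t *\<^sub>R v)) (at (cos t *\<^sub>R x + sin t *\<^sub>R v))"
    using F ne by (auto simp: C1_on_def)
  from vector_derivative_diff_chain_within[OF g, of F] this show ?thesis
    by (auto simp: o_def intro: has_derivative_at_withinI)
qed

lemma C1_great_circle_bound:
  fixes F :: "'a::real_inner \<Rightarrow> real"
  assumes F: "C1_on (- {0}) F F'" and xv: "norm x = 1" "norm v = 1" "x \<bullet> v = 0"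
    and L: "\<forall>y\<in>sphere 0 1. norm (F' y) \<le> L"
  shows "\<bar>F (cos \<theta> *\<^sub>R x + sin \<theta> *\<^sub>R v) - F x\<bar> \<le> L * \<bar>\<theta>\<bar>"
proof -
  let ?\<gamma> = "\<lambda>t. cos t *\<^sub>R x + sin t *\<^sub>R v"
  have "norm (F (?\<gamma> \<theta>) - F (?\<gamma> 0)) \<le> L * norm (\<theta> - 0)"
  proof (rule field_differentiable_bound[where S = UNIV and f' = "\<lambda>t. F' (?\<gamma> t) (cos t *\<^sub>R v - sin t *\<^sub>R x)"])
    fix t
    show "((\<lambda>t. F (?\<gamma> t)) has_field_derivative F' (?\<gamma> t) (cos t *\<^sub>R v - sin t *\<^sub>R x)) (at t within UNIV)"
      using C1_great_circle_derivative[OF F xv] by (simp add: has_real_derivative_iff_has_vector_derivative)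
    have "norm (F' (?\<gamma> t) (cos t *\<^sub>R v - sin t *\<^sub>R x)) \<le> norm (F' (?\<gamma> t)) * 1"
      using norm_blinfun[of "F' (?\<gamma> t)" "cos t *\<^sub>R v - sin t *\<^sub>R x"] norm_great_circle[OF xv, of t] by simp
    also have "\<dots> \<le> L" using L norm_great_circle[OF xv, of t] by simp
    finally show "norm (F' (?\<gamma> t) (cos t *\<^sub>R v - sin t *\<^sub>R x)) \<le> L" .
  qed auto
  then show ?thesis by simp
qed

text \<open>Taylor's formula at \<theta> and - \<theta>, where the linear terms cancel. A great
  circle has acceleration minus its position, so the second derivative along it contains a
  first-derivative term besides the Hessian term; this is why \<open>L1\<close> enters next to
  \<open>L2\<close>.\<close>

lemma C2_great_circle_bound:
  fixes F :: "'a::real_inner \<Rightarrow> real"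
  assumes F: "C1_on (- {0}) F F'" "C1_on (- {0}) F' F''" and xv: "norm x = 1" "norm v = 1" "x \<bullet> v = 0"
    and L: "\<forall>y\<in>sphere 0 1. norm (F' y) \<le> L1 \<and> norm (F'' y) \<le> L2"
  shows "\<bar>F (cos \<theta> *\<^sub>R x + sin \<theta> *\<^sub>R v) + F (cos \<theta> *\<^sub>R x - sin \<theta> *\<^sub>R v) - 2 * F x\<bar> \<le> (L1 + L2) * \<theta>\<^sup>2"
proof -
  let ?\<gamma> = "\<lambda>t. cos t *\<^sub>R x + sin t *\<^sub>R v"
  let ?\<gamma>' = "\<lambda>t. cos t *\<^sub>R v - sin t *\<^sub>R x"
  note n = norm_great_circle[OF xv]
  define G where "G t = F (?\<gamma> t)" for t
  define G1 where "G1 t = F' (?\<gamma> t) (?\<gamma>' t)" for t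
  define G2 where "G2 t = F'' (?\<gamma> t) (?\<gamma>' t) (?\<gamma>' t) - F' (?\<gamma> t) (?\<gamma> t)" for t
  have d1: "(G has_real_derivative G1 t) (at t)" for t
    unfolding G_def G1_def using C1_great_circle_derivative[OF F(1) xv]
    by (simp add: has_real_derivative_iff_has_vector_derivative)
  have d2: "(G1 has_real_derivative G2 t) (at t)" for t
  proof -
    have a: "((\<lambda>t. F' (?\<gamma> t)) has_vector_derivative F'' (?\<gamma> t) (?\<gamma>' t)) (at t)"
      by (rule C1_great_circle_derivative[OF F(2) xv])
    \<comment> \<open>The acceleration of the curve, source of the second term of
      \<open>G2\<close>.\<close>
    have b: "(?\<gamma>' has_vector_derivative (- ?\<gamma> t)) (at t)"
      by (auto intro!: derivative_eq_intros simp: has_real_derivative_iff_has_vector_derivative[symmetric])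
    have "((\<lambda>t. blinfun_apply (F' (?\<gamma> t)) (?\<gamma>' t)) has_vector_derivative
       (blinfun_apply (F' (?\<gamma> t)) (- ?\<gamma> t) + blinfun_apply (blinfun_apply (F'' (?\<gamma> t)) (?\<gamma>' t)) (?\<gamma>' t))) (at t)"
      by (rule bounded_bilinear.has_vector_derivative[OF bounded_bilinear_blinfun_apply a b])
    then show ?thesis
      unfolding G1_def G2_def has_real_derivative_iff_has_vector_derivative
      by (simp add: blinfun.minus_right blinfun.add_right blinfun.diff_right algebra_simps)
  qed
  have bd: "\<bar>G2 t\<bar> \<le> L1 + L2" for t
  proof -
    have "norm (F' (?\<gamma> t) (?\<gamma> t)) \<le> norm (F' (?\<gamma> t))"
      using norm_blinfun[of "F' (?\<gamma> t)" "?\<gamma> t"] n[of t] by simp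
    moreover have "norm (F'' (?\<gamma> t) (?\<gamma>' t) (?\<gamma>' t)) \<le> norm (F'' (?\<gamma> t) (?\<gamma>' t))"
      using norm_blinfun[of "F'' (?\<gamma> t) (?\<gamma>' t)" "?\<gamma>' t"] n[of t] by simp
    moreover have "norm (F'' (?\<gamma> t) (?\<gamma>' t)) \<le> norm (F'' (?\<gamma> t))"
      using norm_blinfun[of "F'' (?\<gamma> t)" "?\<gamma>' t"] n[of t] by simp
    moreover have "norm (F' (?\<gamma> t)) \<le> L1" "norm (F'' (?\<gamma> t)) \<le> L2" using L n[of t] by auto
    ultimately show ?thesis unfolding G2_def by (auto simp: abs_le_iff)
  qed
  have taylor: "\<bar>G t - G 0 - G1 0 * t\<bar> \<le> (L1 + L2) / 2 * t\<^sup>2" for t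
  proof (cases "t = 0")
    case False
    \<comment> \<open>The list \<open>[G, G1, G2]\<close> supplies the derivatives by index, as the
      Maclaurin theorem expects; \<open>t\<close> may have either sign.\<close>
    have "\<exists>s. G t = (\<Sum>m<2. ([G, G1, G2] ! m) 0 / fact m * t ^ m) + ([G, G1, G2] ! 2) s / fact 2 * t ^ 2"
    proof -
      have "\<exists>s. \<bar>s\<bar> \<le> \<bar>t\<bar> \<and> G t = (\<Sum>m<2. ([G, G1, G2] ! m) 0 / fact m * t ^ m) + ([G, G1, G2] ! 2) s / fact 2 * t ^ 2"
        by (rule Maclaurin_bi_le) (auto simp: less_2_cases_iff d1 d2)
      then show ?thesis by blast
    qed
    then obtain s where "G t = G 0 + G1 0 * t + G2 s / 2 * t\<^sup>2"
      by (auto simp: numeral_2_eq_2)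
    then have "\<bar>G t - G 0 - G1 0 * t\<bar> = \<bar>G2 s\<bar> / 2 * t\<^sup>2" by (simp add: abs_mult)
    also have "\<dots> \<le> (L1 + L2) / 2 * t\<^sup>2" using bd[of s] by (intro mult_right_mono) auto
    finally show ?thesis .
  qed simp
  have "\<bar>G \<theta> + G (- \<theta>) - 2 * G 0\<bar> \<le> (L1 + L2) * \<theta>\<^sup>2"
  proof -
    define c where "c = (L1 + L2) / 2 * \<theta>\<^sup>2"
    have "\<bar>G \<theta> - G 0 - G1 0 * \<theta>\<bar> \<le> c" "\<bar>G (- \<theta>) - G 0 + G1 0 * \<theta>\<bar> \<le> c" "(L1 + L2) * \<theta>\<^sup>2 = 2 * c"
      using taylor[of \<theta>] taylor[of "- \<theta>"] by (simp_all add: c_def)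
    then show ?thesis by linarith
  qed
  then show ?thesis by (simp add: G_def)
qed

section \<open>The error of the estimator\<close>

lemma poly_le_sphere_bounded: "p \<in> poly_le d \<Longrightarrow> sphere_bounded p"
  by (intro sphere_bounded_continuous poly_le_continuous)

text \<open>Least squares against the monomials. This ensures that the choice operator in
  \<open>proj_sq_norm\<close> returns a genuine projection.\<close>

lemma poly_projection_exists:
  fixes h :: "real^'n \<Rightarrow> real"
  assumes int: "\<And>u. sphere_bounded u \<Longrightarrow> integrable M u" and h: "sphere_bounded h"
  shows "\<exists>p. p \<in> poly_le d \<and> (\<forall>q\<in>poly_le d. (\<integral>y. (h y - p y) * q y \<partial>M) = 0)"
proof -
  let ?A = "{\<alpha> :: 'n \<Rightarrow> nat. sum \<alpha> UNIV \<le> d}"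
  define \<phi> where "\<phi> \<alpha> y = (\<Prod>i\<in>UNIV. (y $ i) ^ \<alpha> i)" for \<alpha> and y :: "real^'n"
  have \<phi>: "sphere_bounded (\<phi> \<alpha>)" for \<alpha>
    unfolding \<phi>_def by (intro sphere_bounded_continuous continuous_intros)
  obtain c where c: "sphere_bounded (\<lambda>y. h y - (\<Sum>\<alpha>\<in>?A. c \<alpha> * \<phi> \<alpha> y))"
      "\<And>\<beta>. \<beta> \<in> ?A \<Longrightarrow> (\<integral>y. (h y - (\<Sum>\<alpha>\<in>?A. c \<alpha> * \<phi> \<alpha> y)) * \<phi> \<beta> y \<partial>M) = 0"
  proof -
    have "\<exists>c. (\<lambda>y. h y - (\<Sum>\<alpha>\<in>?A. c \<alpha> * \<phi> \<alpha> y)) \<in> Collect sphere_bounded \<and>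
       (\<forall>\<beta>\<in>?A. (\<integral>y. (h y - (\<Sum>\<alpha>\<in>?A. c \<alpha> * \<phi> \<alpha> y)) * \<phi> \<beta> y \<partial>M) = 0)"
      using h \<phi> by (intro least_squares_exists finite_multiindices)
        (auto intro!: int sphere_bounded_intros)
    then show ?thesis using that by auto
  qed
  define p where "p y = (\<Sum>\<alpha>\<in>?A. c \<alpha> * \<phi> \<alpha> y)" for y
  have "p \<in> poly_le d" unfolding p_def \<phi>_def by (auto simp: poly_le_def)
  moreover have "(\<integral>y. (h y - p y) * q y \<partial>M) = 0" if q_poly: "q \<in> poly_le d" for q
  proof -
    obtain b where q: "q = (\<lambda>y. \<Sum>\<alpha>\<in>?A. b \<alpha> * \<phi> \<alpha> y)"
      using q_poly by (auto simp: poly_le_def \<phi>_def)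
    have "(\<integral>y. (h y - p y) * q y \<partial>M) = (\<integral>y. (\<Sum>\<alpha>\<in>?A. b \<alpha> * ((h y - p y) * \<phi> \<alpha> y)) \<partial>M)"
      unfolding q by (simp add: sum_distrib_left algebra_simps)
    also have "\<dots> = (\<Sum>\<alpha>\<in>?A. b \<alpha> * (\<integral>y. (h y - p y) * \<phi> \<alpha> y \<partial>M))"
      using c(1) \<phi> int unfolding p_def
      by (subst Bochner_Integration.integral_sum) (auto intro!: integrable_mult_right int sphere_bounded_mult)
    also have "\<dots> = 0" using c(2) unfolding p_def by (intro sum.neutral) auto
    finally show ?thesis .
  qed
  ultimately show ?thesis by blast
qed

text \<open>Pythagoras twice: the residual \<open>h - p\<close> is orthogonal to \<open>p\<close>
  and to \<open>p - q\<close>. Hence the missing mass is the squared norm of \<open>h - p\<close>,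
  which is at most that of \<open>h - q\<close>. Both bounds hold for whichever projection the
  choice operator returns.\<close>

lemma proj_sq_norm_bounds:
  fixes h :: "real^'n \<Rightarrow> real"
  assumes int: "\<And>u. sphere_bounded u \<Longrightarrow> integrable M u" and h: "sphere_bounded h"
    and q: "q \<in> poly_le d"
  shows "proj_sq_norm M d h \<le> (\<integral>y. (h y)\<^sup>2 \<partial>M)"
    and "(\<integral>y. (h y)\<^sup>2 \<partial>M) - (\<integral>y. (h y - q y)\<^sup>2 \<partial>M) \<le> proj_sq_norm M d h"
proof -
  define p where "p = (SOME p. p \<in> poly_le d \<and> (\<forall>q\<in>poly_le d. (\<integral>y. (h y - p y) * q y \<partial>M) = 0))"
  have p: "p \<in> poly_le d" "\<And>q. q \<in> poly_le d \<Longrightarrow> (\<integral>y. (h y - p y) * q y \<partial>M) = 0"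
    using someI_ex[OF poly_projection_exists[OF int h, of d]] unfolding p_def[symmetric] by auto
  note sb = h poly_le_sphere_bounded[OF p(1)] poly_le_sphere_bounded[OF q]
  have P: "proj_sq_norm M d h = (\<integral>y. (p y)\<^sup>2 \<partial>M)"
    by (simp add: proj_sq_norm_def p_def)
  have i: "integrable M (\<lambda>y. (h y - p y)\<^sup>2)" "integrable M (\<lambda>y. (p y)\<^sup>2)"
     "integrable M (\<lambda>y. (h y - p y) * p y)" "integrable M (\<lambda>y. (p y - q y)\<^sup>2)"
     "integrable M (\<lambda>y. (h y - p y) * (p y - q y))"
    using sb by (auto intro!: int sphere_bounded_intros)
  have "(\<integral>y. (h y)\<^sup>2 \<partial>M) = (\<integral>y. (h y - p y)\<^sup>2 + 2 * ((h y - p y) * p y) + (p y)\<^sup>2 \<partial>M)"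
    by (intro Bochner_Integration.integral_cong) (auto simp: power2_eq_square algebra_simps)
  also have "\<dots> = (\<integral>y. (h y - p y)\<^sup>2 \<partial>M) + (\<integral>y. (p y)\<^sup>2 \<partial>M)"
    using i p(2)[OF p(1)] by simp
  finally have 1: "(\<integral>y. (h y)\<^sup>2 \<partial>M) = (\<integral>y. (h y - p y)\<^sup>2 \<partial>M) + (\<integral>y. (p y)\<^sup>2 \<partial>M)" .
  have pq: "(\<lambda>y. p y - q y) \<in> poly_le d"
    using poly_le_add[OF p(1) poly_le_cmult[OF q, of "-1"]] by simp
  have "(\<integral>y. (h y - q y)\<^sup>2 \<partial>M) = (\<integral>y. (h y - p y)\<^sup>2 + 2 * ((h y - p y) * (p y - q y)) + (p y - q y)\<^sup>2 \<partial>M)"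
    by (intro Bochner_Integration.integral_cong) (auto simp: power2_eq_square algebra_simps)
  also have "\<dots> = (\<integral>y. (h y - p y)\<^sup>2 \<partial>M) + (\<integral>y. (p y - q y)\<^sup>2 \<partial>M)"
    using i p(2)[OF pq] by simp
  finally have 2: "(\<integral>y. (h y - q y)\<^sup>2 \<partial>M) = (\<integral>y. (h y - p y)\<^sup>2 \<partial>M) + (\<integral>y. (p y - q y)\<^sup>2 \<partial>M)" .
  have "(\<integral>y. (h y - p y)\<^sup>2 \<partial>M) \<ge> 0" "(\<integral>y. (p y - q y)\<^sup>2 \<partial>M) \<ge> 0" by simp_all
  with 1 2 P show "proj_sq_norm M d h \<le> (\<integral>y. (h y)\<^sup>2 \<partial>M)"
    "(\<integral>y. (h y)\<^sup>2 \<partial>M) - (\<integral>y. (h y - q y)\<^sup>2 \<partial>M) \<le> proj_sq_norm M d h" by linarith+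
qed

section \<open>Integration against the density and splitting of the error\<close>

lemma sphere_bounded_density:
  fixes f :: "real^'n \<Rightarrow> real"
  assumes [measurable]: "f \<in> borel_measurable borel" and m: "0 < m"
    and f: "\<forall>y\<in>sphere 0 1. m \<le> f y \<and> f y \<le> M"
  shows "sphere_bounded f" "sphere_bounded (\<lambda>y. 1 / f y)"
proof -
  have "\<forall>y\<in>sphere 0 1. \<bar>f y\<bar> \<le> M" using f m by force
  then show "sphere_bounded f" by (auto simp: sphere_bounded_def)
  have "\<forall>y\<in>sphere 0 1. \<bar>1 / f y\<bar> \<le> 1 / m"
    using f m by (fastforce intro!: divide_left_mono)
  then show "sphere_bounded (\<lambda>y. 1 / f y)" by (auto simp: sphere_bounded_def)
qed

lemma
  fixes f :: "real^'n \<Rightarrow> real"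
  assumes f[measurable]: "f \<in> borel_measurable borel" and m: "0 < m"
    and fb: "\<forall>y\<in>sphere 0 1. m \<le> f y \<and> f y \<le> M" and u: "sphere_bounded u"
  shows integrable_sphere_density: "integrable (density sphere_measure (\<lambda>y. ennreal (f y))) u"
    and integral_sphere_density:
      "(\<integral>y. u y \<partial>density sphere_measure (\<lambda>y. ennreal (f y))) = (\<integral>y. f y * u y \<partial>sphere_measure)"
proof -
  have [measurable]: "u \<in> borel_measurable borel" using u by (simp add: sphere_bounded_def)
  have pos: "AE y in sphere_measure. 0 \<le> f y"
    using AE_sphere_measure by eventually_elim (meson fb m less_imp_le order.trans)
  have "integrable sphere_measure (\<lambda>y. f y * u y)"
    using sphere_bounded_density[OF f m fb] u by (auto intro!: sphere_bounded_integrable sphere_bounded_intros)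
  then show "integrable (density sphere_measure (\<lambda>y. ennreal (f y))) u"
    using pos by (subst integrable_density) auto
  show "(\<integral>y. u y \<partial>density sphere_measure (\<lambda>y. ennreal (f y))) = (\<integral>y. f y * u y \<partial>sphere_measure)"
    using pos by (subst integral_density) auto
qed

text \<open>The three terms are the bias of the weighted mean of \<open>1 / f\<close>, the cost of
  replacing \<open>1 / f\<close> by its value at \<open>x\<close> in the approximant, and the
  truncation error of the kernel divided by the integral \<open>K\<close>. Only the first depends on
  whether the regularity is of order one or two.\<close>

lemma ghat_error_bound:
  fixes f :: "real^'n \<Rightarrow> real" and x :: "real^'n"
  assumes f[measurable]: "f \<in> borel_measurable borel" and m: "0 < m"
    and fb: "\<forall>y\<in>sphere 0 1. m \<le> f y \<and> f y \<le> M" and x: "norm x = 1"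
    and k: "k = nat \<lfloor>real d powr (4/3)\<rfloor>" "k \<ge> 1"
    and lip: "\<And>y. y \<in> sphere 0 1 \<Longrightarrow> (1 / f y - 1 / f x)\<^sup>2 \<le> A * (1 - x \<bullet> y)"
    and bias: "\<bar>\<integral>y. (1 / f y - 1 / f x) * phi x (2 * k) y \<partial>sphere_measure\<bar>
       \<le> b * (\<integral>y. phi x (2 * k) y \<partial>sphere_measure)"
  shows "\<bar>ghat f d x - 1 / f x\<bar> \<le> b + M * A * CARD('n) / k +
     2 * M / m\<^sup>2 * ((2 * exp (- (real d)\<^sup>2 / real k))\<^sup>2 * (2 * real (2 * k) ^ (CARD('n) - 1)))"
proof -
  interpret prob_space "sphere_measure :: (real^'n) measure" by (rule prob_space_sphere_measure)
  define \<mu> where "\<mu> = density sphere_measure (\<lambda>y. ennreal (f y))"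
  define \<epsilon> where "\<epsilon> = 2 * exp (- (real d)\<^sup>2 / real k)"
  define K where "K = (\<integral>y. phi x (2 * k) y \<partial>sphere_measure)"
  define g0 where "g0 = 1 / f x"
  define h where "h y = phi x k y / f y" for y
  note fsb = sphere_bounded_density[OF f m fb]
  have psb: "sphere_bounded (phi x j)" for j by (intro sphere_bounded_continuous continuous_intros)
  have hsb: "sphere_bounded h"
    using sphere_bounded_mult[OF psb[of k] fsb(2)] by (simp add: h_def[abs_def])
  have xs: "x \<in> sphere 0 1" using x by simp
  have M0: "M > 0" and g0: "0 < g0" "g0 \<le> 1 / m"
    using fb xs m by (force simp: g0_def intro!: divide_left_mono divide_pos_pos)+
  \<comment> \<open>The Lipschitz hypothesis at the antipode, where
    \<open>1 - x \<bullet> y = 2\<close>.\<close>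
  have A0: "A \<ge> 0"
    using order.trans[OF zero_le_power2 lip[of "- x"]] x by (simp add: norm_eq_1)
  have K_lower: "K \<ge> 1 / (2 * real (2 * k) ^ (CARD('n) - 1))"
    using phi_integral_lower_bound[OF x, of "2 * k - 1"] k(2) by (simp add: K_def)
  then have K0: "K > 0" using k(2) by (intro less_le_trans[OF _ K_lower]) simp
  have int: "integrable \<mu> u" and integral: "(\<integral>y. u y \<partial>\<mu>) = (\<integral>y. f y * u y \<partial>sphere_measure)"
    if "sphere_bounded u" for u
    using that integrable_sphere_density[OF f m fb] integral_sphere_density[OF f m fb] by (simp_all add: \<mu>_def)
  obtain Q where Q: "Q \<in> poly_le d" "\<And>y. \<bar>x \<bullet> y\<bar> \<le> 1 \<Longrightarrow> \<bar>phi x k y - Q y\<bar> \<le> \<epsilon>"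
    using phi_approximation[OF k(2), of d x] unfolding \<epsilon>_def by blast
  \<comment> \<open>The kernel concentrates near \<open>x\<close>, so \<open>h\<close> is close to
    \<open>g0\<close> times the kernel, which \<open>Q\<close> approximates.\<close>
  define q where "q y = g0 * Q y" for y
  have q: "q \<in> poly_le d" unfolding q_def by (rule poly_le_cmult[OF Q(1)])
  define P where "P = proj_sq_norm \<mu> d h"
  have gh: "ghat f d x = P / K"
    by (simp add: ghat_def P_def \<mu>_def h_def[abs_def] K_def phi_square k(1) Let_def)
  note bounds = proj_sq_norm_bounds[OF int hsb q, folded P_def]
  have H: "(\<integral>y. (h y)\<^sup>2 \<partial>\<mu>) = (\<integral>y. 1 / f y * phi x (2 * k) y \<partial>sphere_measure)"
  proof -
    have "(\<integral>y. (h y)\<^sup>2 \<partial>\<mu>) = (\<integral>y. f y * (h y)\<^sup>2 \<partial>sphere_measure)"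
      using hsb by (intro integral sphere_bounded_intros)
    also have "\<dots> = (\<integral>y. 1 / f y * phi x (2 * k) y \<partial>sphere_measure)"
    proof (rule integral_cong_AE)
      show "AE y in sphere_measure. f y * (h y)\<^sup>2 = 1 / f y * phi x (2 * k) y"
        using AE_sphere_measure
      proof eventually_elim
        case (elim y)
        then have "f y > 0" using fb m by force
        then show ?case unfolding phi_square[symmetric] h_def by (simp add: power2_eq_square)
      qed
      show "(\<lambda>y. f y * (h y)\<^sup>2) \<in> borel_measurable sphere_measure"
        using hsb by (auto simp: sphere_bounded_def)
      show "(\<lambda>y. 1 / f y * phi x (2 * k) y) \<in> borel_measurable sphere_measure"
        using sphere_bounded_mult[OF fsb(2) psb[of "2 * k"]]
        by (simp add: sphere_bounded_def cong: measurable_cong_sets)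
    qed
    finally show ?thesis .
  qed
  have Hb: "\<bar>(\<integral>y. (h y)\<^sup>2 \<partial>\<mu>) - g0 * K\<bar> \<le> b * K"
  proof -
    have "(\<integral>y. (1 / f y - 1 / f x) * phi x (2 * k) y \<partial>sphere_measure)
       = (\<integral>y. 1 / f y * phi x (2 * k) y - g0 * phi x (2 * k) y \<partial>sphere_measure)"
      by (simp add: g0_def algebra_simps)
    also have "\<dots> = (\<integral>y. (h y)\<^sup>2 \<partial>\<mu>) - g0 * K"
      using sphere_bounded_integrable[OF psb] sphere_bounded_integrable[OF sphere_bounded_mult[OF fsb(2) psb]]
      unfolding H K_def by simp
    finally show ?thesis using bias unfolding K_def by simp
  qed
  have E: "(\<integral>y. (h y - q y)\<^sup>2 \<partial>\<mu>) \<le> M * A * CARD('n) / k * K + 2 * M / m\<^sup>2 * \<epsilon>\<^sup>2"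
  proof -
    have "(\<integral>y. (h y - q y)\<^sup>2 \<partial>\<mu>) = (\<integral>y. f y * (h y - q y)\<^sup>2 \<partial>sphere_measure)"
      using hsb poly_le_sphere_bounded[OF q] by (intro integral sphere_bounded_intros)
    also have "\<dots> \<le> (\<integral>y. 2 * M * A * ((1 - x \<bullet> y) * phi x (2 * k) y) + 2 * M / m\<^sup>2 * \<epsilon>\<^sup>2 \<partial>sphere_measure)"
    proof (rule integral_mono_AE)
      show "integrable sphere_measure (\<lambda>y. f y * (h y - q y)\<^sup>2)"
        using hsb fsb poly_le_sphere_bounded[OF q] by (auto intro!: sphere_bounded_integrable sphere_bounded_intros)
      show "integrable sphere_measure (\<lambda>y. 2 * M * A * ((1 - x \<bullet> y) * phi x (2 * k) y) + 2 * M / m\<^sup>2 * \<epsilon>\<^sup>2)"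
        by (intro integrable_sphere_measure_continuous continuous_intros)
      show "AE y in sphere_measure. f y * (h y - q y)\<^sup>2 \<le> 2 * M * A * ((1 - x \<bullet> y) * phi x (2 * k) y) + 2 * M / m\<^sup>2 * \<epsilon>\<^sup>2"
        using AE_sphere_measure
      proof eventually_elim
        case (elim y)
        have fy: "f y > 0" "f y \<le> M" using fb m elim by force+
        have xy: "\<bar>x \<bullet> y\<bar> \<le> 1" using x elim by (rule abs_inner_sphere_le_1)
        \<comment> \<open>\<open>a\<close> carries the variation of \<open>1 / f\<close> and
          \<open>c\<close> the truncation of the kernel; together they make up
          \<open>h - q\<close>.\<close>
        define a where "a = phi x k y * (1 / f y - g0)"
        define c where "c = g0 * (phi x k y - Q y)"
        have "h y - q y = a + c" by (simp add: h_def q_def a_def c_def algebra_simps)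
        moreover have "(a + c)\<^sup>2 \<le> 2 * a\<^sup>2 + 2 * c\<^sup>2"
          using zero_le_power2[of "a - c"] unfolding power2_sum power2_diff by linarith
        moreover have "a\<^sup>2 \<le> A * (1 - x \<bullet> y) * phi x (2 * k) y"
        proof -
          have "a\<^sup>2 = (1 / f y - 1 / f x)\<^sup>2 * phi x (2 * k) y"
            by (simp add: a_def g0_def power_mult_distrib phi_square mult.commute)
          also have "\<dots> \<le> A * (1 - x \<bullet> y) * phi x (2 * k) y"
            using lip[OF elim] phi_nonneg[OF xy] by (intro mult_right_mono) auto
          finally show ?thesis .
        qed
        moreover have "c\<^sup>2 \<le> 1 / m\<^sup>2 * \<epsilon>\<^sup>2"
        proof -
          have "c\<^sup>2 = g0\<^sup>2 * \<bar>phi x k y - Q y\<bar>\<^sup>2" by (simp add: c_def power_mult_distrib)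
          also have "\<dots> \<le> (1 / m)\<^sup>2 * \<epsilon>\<^sup>2"
            using g0 Q(2)[OF xy] by (intro mult_mono power_mono) auto
          finally show ?thesis by (simp add: power_divide)
        qed
        ultimately have "(h y - q y)\<^sup>2 \<le> 2 * (A * (1 - x \<bullet> y) * phi x (2 * k) y) + 2 * (1 / m\<^sup>2 * \<epsilon>\<^sup>2)"
          by simp
        then have "f y * (h y - q y)\<^sup>2 \<le> M * (2 * (A * (1 - x \<bullet> y) * phi x (2 * k) y) + 2 * (1 / m\<^sup>2 * \<epsilon>\<^sup>2))"
          using fy M0 by (intro mult_mono) auto
        then show ?case by (simp add: algebra_simps)
      qed
    qed
    also have "\<dots> = 2 * M * A * (\<integral>y. (1 - x \<bullet> y) * phi x (2 * k) y \<partial>sphere_measure) + 2 * M / m\<^sup>2 * \<epsilon>\<^sup>2"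
    proof -
      have "integrable sphere_measure (\<lambda>y. (1 - x \<bullet> y) * phi x (2 * k) y)"
        by (intro integrable_sphere_measure_continuous continuous_intros)
      then show ?thesis using prob_space by simp
    qed
    also have "\<dots> \<le> 2 * M * A * (real CARD('n) / real (2 * k) * K) + 2 * M / m\<^sup>2 * \<epsilon>\<^sup>2"
      using phi_first_moment_le[OF x, of "2 * k"] k(2) A0 M0
      by (intro add_right_mono mult_left_mono) (auto simp: K_def)
    \<comment> \<open>The 2 from the squared sum cancels against the exponent \<open>2 * k\<close>
      in the moment bound.\<close>
    also have "\<dots> = M * A * CARD('n) / k * K + 2 * M / m\<^sup>2 * \<epsilon>\<^sup>2" by simp
    finally show ?thesis .
  qed
  \<comment> \<open>From above only the bias enters; from below the squared distance from
    \<open>h\<close> to \<open>q\<close> is lost in addition.\<close>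
  have "\<bar>P - g0 * K\<bar> \<le> b * K + M * A * CARD('n) / k * K + 2 * M / m\<^sup>2 * \<epsilon>\<^sup>2"
    using bounds Hb E M0 A0 K0 by (auto simp: abs_le_iff intro: add_nonneg_nonneg)
  then have "\<bar>P - g0 * K\<bar> / K \<le> (b * K + M * A * CARD('n) / k * K + 2 * M / m\<^sup>2 * \<epsilon>\<^sup>2) / K"
    using K0 by (intro divide_right_mono) auto
  also have "\<dots> = b + M * A * CARD('n) / k + 2 * M / m\<^sup>2 * (\<epsilon>\<^sup>2 * (1 / K))"
    using K0 by (simp add: add_divide_distrib)
  also have "\<dots> \<le> b + M * A * CARD('n) / k + 2 * M / m\<^sup>2 * (\<epsilon>\<^sup>2 * (2 * real (2 * k) ^ (CARD('n) - 1)))"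
  proof -
    have "1 / K \<le> 1 / (1 / (2 * real (2 * k) ^ (CARD('n) - 1)))"
      using K_lower k(2) K0 by (intro divide_left_mono) (auto intro!: divide_pos_pos)
    then show ?thesis using M0 by (intro add_left_mono mult_left_mono) auto
  qed
  also have "\<bar>P - g0 * K\<bar> / K = \<bar>ghat f d x - 1 / f x\<bar>"
  proof -
    have "ghat f d x - 1 / f x = (P - g0 * K) / K" using K0 by (simp add: gh g0_def field_simps)
    then show ?thesis using K0 by (simp add: abs_divide)
  qed
  finally show ?thesis unfolding \<epsilon>_def .
qed

section \<open>Increments of a function on the sphere\<close>

lemma great_circle_reflection:
  fixes x v :: "'a::real_inner"
  assumes "norm x = 1" "x \<bullet> v = 0" "y = cos \<theta> *\<^sub>R x + sin \<theta> *\<^sub>R v"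
  shows "(2 * (x \<bullet> y)) *\<^sub>R x - y = cos \<theta> *\<^sub>R x - sin \<theta> *\<^sub>R v"
proof -
  have "x \<bullet> y = cos \<theta>" using assms by (simp add: inner_simps norm_eq_1)
  then show ?thesis using assms(3) by (simp add: algebra_simps flip: scaleR_add_left)
qed

text \<open>Away from the poles, the mean value bound along the great circle is converted by
  \<open>\<theta> ^ 2 \<le> 16 * (1 - cos \<theta>)\<close>. At the antipode the crude bound
  \<open>c\<close> on the oscillation suffices, since \<open>1 - x \<bullet> y = 2\<close> there;
  hence the summand \<open>c ^ 2\<close>.\<close>

lemma C1_sphere_increment:
  fixes g :: "real^'n \<Rightarrow> real"
  assumes C1: "C1_on (- {0}) (sph_ext g) G'" and L: "\<forall>y\<in>sphere 0 1. norm (G' y) \<le> L1"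
    and g: "\<And>y. y \<in> sphere 0 1 \<Longrightarrow> 0 \<le> g y \<and> g y \<le> c"
    and x: "norm x = 1" and y: "y \<in> sphere 0 1"
  shows "(g y - g x)\<^sup>2 \<le> (16 * L1\<^sup>2 + c\<^sup>2) * (1 - x \<bullet> y)"
proof -
  have ext: "sph_ext g z = g z" if "norm z = 1" for z using that by (simp add: sph_ext_def)
  have ny: "norm y = 1" using y by simp
  have xx: "x \<bullet> x = 1" using x by (simp add: norm_eq_1)
  consider "y = x" | "y = - x" | "y \<noteq> x" "y \<noteq> - x" by blast
  then show ?thesis
  proof cases
    case 1
    then show ?thesis using xx by simp
  next
    case 2
    have "\<bar>g y - g x\<bar> \<le> c" using g[of x] g[of y] x y by (auto simp: abs_le_iff)
    then have "(g y - g x)\<^sup>2 \<le> c\<^sup>2" using power_mono[of "\<bar>g y - g x\<bar>" c 2] by simp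
    also have "\<dots> \<le> (16 * L1\<^sup>2 + c\<^sup>2) * 2" by simp
    finally show ?thesis using 2 xx by simp
  next
    case 3
    obtain v \<theta> where v: "norm v = 1" "x \<bullet> v = 0" "0 \<le> \<theta>" "\<theta> \<le> pi" "x \<bullet> y = cos \<theta>"
      "y = cos \<theta> *\<^sub>R x + sin \<theta> *\<^sub>R v"
      using great_circle_coordinates[OF x ny 3] by metis
    have "\<bar>g y - g x\<bar> \<le> L1 * \<theta>"
      using C1_great_circle_bound[OF C1 x v(1,2) L, of \<theta>] v(3) x ny by (simp add: ext flip: v(6))
    then have "(g y - g x)\<^sup>2 \<le> L1\<^sup>2 * \<theta>\<^sup>2"
      using power_mono[of "\<bar>g y - g x\<bar>" "L1 * \<theta>" 2] by (simp add: power_mult_distrib)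
    also have "\<dots> \<le> L1\<^sup>2 * (16 * (1 - cos \<theta>))"
      by (intro mult_left_mono square_le_one_minus_cos v) auto
    also have "\<dots> \<le> (16 * L1\<^sup>2 + c\<^sup>2) * (1 - x \<bullet> y)"
    proof -
      have "c\<^sup>2 * (1 - cos \<theta>) \<ge> 0" by simp
      then show ?thesis unfolding v(5) by (simp add: algebra_simps)
    qed
    finally show ?thesis .
  qed
qed

text \<open>Reflection in the line of \<open>x\<close> runs the great circle backwards, so this is
  the symmetric second difference of \<open>g\<close> along it. The antipode is fixed by the
  reflection and is covered by the summand \<open>c\<close>.\<close>

lemma C2_sphere_second_difference:
  fixes g :: "real^'n \<Rightarrow> real"
  assumes C2: "C1_on (- {0}) (sph_ext g) G'" "C1_on (- {0}) G' G''"
    and L: "\<forall>y\<in>sphere 0 1. norm (G' y) \<le> L1 \<and> norm (G'' y) \<le> L2"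
    and g: "\<And>y. y \<in> sphere 0 1 \<Longrightarrow> 0 \<le> g y \<and> g y \<le> c"
    and x: "norm x = 1" and y: "y \<in> sphere 0 1"
  shows "\<bar>g y + g ((2 * (x \<bullet> y)) *\<^sub>R x - y) - 2 * g x\<bar> \<le> (16 * (L1 + L2) + c) * (1 - x \<bullet> y)"
proof -
  have ext: "sph_ext g z = g z" if "norm z = 1" for z using that by (simp add: sph_ext_def)
  have ny: "norm y = 1" using y by simp
  have xx: "x \<bullet> x = 1" using x by (simp add: norm_eq_1)
  have c0: "c \<ge> 0" using g[of x] x by auto
  have L0: "L1 + L2 \<ge> 0" using L x by (metis add_nonneg_nonneg mem_sphere_0 norm_ge_zero order_trans)
  consider "y = x" | "y = - x" | "y \<noteq> x" "y \<noteq> - x" by blast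
  then show ?thesis
  proof cases
    case 1
    then have "(2 * (x \<bullet> y)) *\<^sub>R x - y = x" using xx by (simp add: scaleR_2)
    then show ?thesis using 1 xx by simp
  next
    case 2
    then have "(2 * (x \<bullet> y)) *\<^sub>R x - y = y" using xx by (simp add: scaleR_2)
    moreover have "\<bar>g y - g x\<bar> \<le> c" using g[of x] g[of y] x y by (auto simp: abs_le_iff)
    moreover have "(16 * (L1 + L2) + c) * (1 - x \<bullet> y) = 32 * (L1 + L2) + 2 * c" using 2 xx by simp
    ultimately show ?thesis using L0 by simp
  next
    case 3
    obtain v \<theta> where v: "norm v = 1" "x \<bullet> v = 0" "0 \<le> \<theta>" "\<theta> \<le> pi" "x \<bullet> y = cos \<theta>"
      "y = cos \<theta> *\<^sub>R x + sin \<theta> *\<^sub>R v"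
      using great_circle_coordinates[OF x ny 3] by metis
    define z where "z = (2 * (x \<bullet> y)) *\<^sub>R x - y"
    have z: "z = cos \<theta> *\<^sub>R x - sin \<theta> *\<^sub>R v"
      unfolding z_def by (rule great_circle_reflection[OF x v(2,6)])
    have nz: "norm z = 1" using norm_great_circle(1)[OF x v(1,2), of "- \<theta>"] by (simp add: z)
    have "\<bar>g y + g z - 2 * g x\<bar> \<le> (L1 + L2) * \<theta>\<^sup>2"
      using C2_great_circle_bound[OF C2 x v(1,2) L, of \<theta>] x ny nz by (simp add: ext flip: v(6) z)
    also have "\<dots> \<le> (L1 + L2) * (16 * (1 - cos \<theta>))"
      using L0 by (intro mult_left_mono square_le_one_minus_cos v) auto
    also have "\<dots> \<le> (16 * (L1 + L2) + c) * (1 - x \<bullet> y)"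
    proof -
      have "c * (1 - cos \<theta>) \<ge> 0" using c0 by simp
      then show ?thesis unfolding v(5) by (simp add: algebra_simps)
    qed
    finally show ?thesis unfolding z_def .
  qed
qed

lemma orthogonal_transformation_line_reflection:
  fixes x :: "real^'n"
  assumes "norm x = 1"
  shows "orthogonal_transformation (\<lambda>y. (2 * (x \<bullet> y)) *\<^sub>R x - y)"
  unfolding orthogonal_transformation_def
proof (intro conjI allI)
  show "linear (\<lambda>y. (2 * (x \<bullet> y)) *\<^sub>R x - y)"
    by (intro linearI) (simp_all add: inner_simps algebra_simps)
  fix v w
  have "x \<bullet> x = 1" using assms by (simp add: norm_eq_1)
  then show "((2 * (x \<bullet> v)) *\<^sub>R x - v) \<bullet> ((2 * (x \<bullet> w)) *\<^sub>R x - w) = v \<bullet> w"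
    by (simp add: inner_simps inner_commute)
qed

text \<open>A linearised Cauchy-Schwarz inequality:
  \<open>\<bar>u\<bar> \<le> s * u ^ 2 + 1 / s\<close> with \<open>s = sqrt k\<close> reduces the
  mean of \<open>\<bar>u\<bar>\<close> to that of \<open>u ^ 2\<close>, which is
  \<open>O(1 / k)\<close> by the first moment bound.\<close>

lemma C1_bias_bound:
  fixes u :: "real^'n \<Rightarrow> real"
  assumes u: "sphere_bounded u" and x: "norm x = 1" and k: "k \<ge> 1"
    and lip: "\<And>y. y \<in> sphere 0 1 \<Longrightarrow> (u y)\<^sup>2 \<le> A * (1 - x \<bullet> y)" and A: "A \<ge> 0"
  shows "\<bar>\<integral>y. u y * phi x (2 * k) y \<partial>sphere_measure\<bar>
    \<le> (A * CARD('n) + 1) / sqrt k * (\<integral>y. phi x (2 * k) y \<partial>sphere_measure)"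
proof -
  let ?\<phi> = "phi x (2 * k)"
  define s where "s = sqrt (real k)"
  have s: "s > 0" "s\<^sup>2 = real k" using k by (simp_all add: s_def)
  have psb: "sphere_bounded ?\<phi>" by (intro sphere_bounded_continuous continuous_intros)
  have int: "integrable sphere_measure ?\<phi>" "integrable sphere_measure (\<lambda>y. (1 - x \<bullet> y) * ?\<phi> y)"
    by (intro integrable_sphere_measure_continuous continuous_intros)+
  have K0: "(\<integral>y. ?\<phi> y \<partial>sphere_measure) \<ge> 0"
    by (rule integral_nonneg_AE)
      (use AE_sphere_measure x in \<open>auto elim!: eventually_mono intro!: phi_nonneg abs_inner_sphere_le_1\<close>)
  have "\<bar>\<integral>y. u y * ?\<phi> y \<partial>sphere_measure\<bar> \<le> (\<integral>y. \<bar>u y * ?\<phi> y\<bar> \<partial>sphere_measure)"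
    by (rule integral_abs_bound)
  also have "\<dots> \<le> (\<integral>y. s * A * ((1 - x \<bullet> y) * ?\<phi> y) + 1 / s * ?\<phi> y \<partial>sphere_measure)"
  proof (rule integral_mono_AE)
    show "integrable sphere_measure (\<lambda>y. \<bar>u y * ?\<phi> y\<bar>)"
      using sphere_bounded_integrable[OF sphere_bounded_mult[OF u psb]] by simp
    show "integrable sphere_measure (\<lambda>y. s * A * ((1 - x \<bullet> y) * ?\<phi> y) + 1 / s * ?\<phi> y)"
      using int by simp
    show "AE y in sphere_measure. \<bar>u y * ?\<phi> y\<bar> \<le> s * A * ((1 - x \<bullet> y) * ?\<phi> y) + 1 / s * ?\<phi> y"
      using AE_sphere_measure
    proof eventually_elim
      case (elim y)
      have p: "?\<phi> y \<ge> 0" using x elim by (intro phi_nonneg abs_inner_sphere_le_1)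
      \<comment> \<open>AM-GM, balanced at the typical size \<open>|u| \<approx> 1 / s\<close>\<close>
      have "s * \<bar>u y\<bar> \<le> s\<^sup>2 * (u y)\<^sup>2 + 1"
        using sum_squares_bound[of "s * \<bar>u y\<bar>" 1] s by (simp add: power_mult_distrib)
          (smt (verit) mult_nonneg_nonneg abs_ge_zero)
      then have "\<bar>u y\<bar> \<le> s * (u y)\<^sup>2 + 1 / s"
        using s(1) by (simp add: field_simps power2_eq_square)
      also have "\<dots> \<le> s * (A * (1 - x \<bullet> y)) + 1 / s"
        using lip[OF elim] s by (intro add_right_mono mult_left_mono) auto
      finally have "\<bar>u y\<bar> * ?\<phi> y \<le> (s * (A * (1 - x \<bullet> y)) + 1 / s) * ?\<phi> y"
        using p by (intro mult_right_mono)
      then show ?case using p by (simp add: abs_mult algebra_simps)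
    qed
  qed
  also have "\<dots> = s * A * (\<integral>y. (1 - x \<bullet> y) * ?\<phi> y \<partial>sphere_measure) + 1 / s * (\<integral>y. ?\<phi> y \<partial>sphere_measure)"
    using int by simp
  also have "\<dots> \<le> s * A * (CARD('n) / real k * (\<integral>y. ?\<phi> y \<partial>sphere_measure)) + 1 / s * (\<integral>y. ?\<phi> y \<partial>sphere_measure)"
  proof (intro add_right_mono mult_left_mono)
    have "(\<integral>y. (1 - x \<bullet> y) * ?\<phi> y \<partial>sphere_measure) \<le> CARD('n) / real (2 * k) * (\<integral>y. ?\<phi> y \<partial>sphere_measure)"
      using phi_first_moment_le[OF x, of "2 * k"] k by simp
    also have "\<dots> \<le> CARD('n) / real k * (\<integral>y. ?\<phi> y \<partial>sphere_measure)"
      using K0 k by (intro mult_right_mono divide_left_mono) auto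
    finally show "(\<integral>y. (1 - x \<bullet> y) * ?\<phi> y \<partial>sphere_measure) \<le> CARD('n) / real k * (\<integral>y. ?\<phi> y \<partial>sphere_measure)" .
  qed (use s A in auto)
  also have "\<dots> = (A * CARD('n) + 1) / s * (\<integral>y. ?\<phi> y \<partial>sphere_measure)"
    using s(1) unfolding s(2)[symmetric] by (simp add: field_simps power2_eq_square)
  finally show ?thesis unfolding s_def .
qed

text \<open>The reflection in the line of \<open>x\<close> preserves both the measure and the
  kernel, so twice the bias is the weighted mean of the symmetric second difference, and
  \<open>diff\<close> reduces this to the first moment of \<open>1 - t\<close>.\<close>

lemma C2_bias_bound:
  fixes g :: "real^'n \<Rightarrow> real"
  assumes g: "sphere_bounded g" and x: "norm x = 1" and k: "k \<ge> 1"
    and diff: "\<And>y. y \<in> sphere 0 1 \<Longrightarrow> \<bar>g y + g ((2 * (x \<bullet> y)) *\<^sub>R x - y) - 2 * g x\<bar> \<le> A * (1 - x \<bullet> y)"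
    and A: "A \<ge> 0"
  shows "\<bar>\<integral>y. (g y - g x) * phi x (2 * k) y \<partial>sphere_measure\<bar>
    \<le> A * CARD('n) / k * (\<integral>y. phi x (2 * k) y \<partial>sphere_measure)"
proof -
  let ?\<phi> = "phi x (2 * k)"
  define T where "T y = (2 * (x \<bullet> y)) *\<^sub>R x - y" for y
  have T: "orthogonal_transformation T"
    unfolding T_def by (rule orthogonal_transformation_line_reflection[OF x])
  have xx: "x \<bullet> x = 1" using x by (simp add: norm_eq_1)
  have \<phi>T: "?\<phi> (T y) = ?\<phi> y" for y using xx by (simp add: phi_def T_def inner_simps)
  have psb: "sphere_bounded ?\<phi>" by (intro sphere_bounded_continuous continuous_intros)
  have gm: "g \<in> borel_measurable borel" using g by (simp add: sphere_bounded_def)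
  have Tm: "T \<in> borel_measurable borel" by (rule orthogonal_transformation_measurable[OF T])
  have gT: "sphere_bounded (\<lambda>y. g (T y))"
  proof -
    obtain B where "\<forall>y\<in>sphere 0 1. \<bar>g y\<bar> \<le> B" using g unfolding sphere_bounded_def by blast
    then have "\<forall>y\<in>sphere 0 1. \<bar>g (T y)\<bar> \<le> B"
      using T by (simp add: orthogonal_transformation)
    then show ?thesis using measurable_compose[OF Tm gm] by (auto simp: sphere_bounded_def)
  qed
  have int: "integrable sphere_measure (\<lambda>y. (g y - g x) * ?\<phi> y)"
    "integrable sphere_measure (\<lambda>y. (g (T y) - g x) * ?\<phi> y)"
    "integrable sphere_measure (\<lambda>y. (g y + g (T y) - 2 * g x) * ?\<phi> y)"
    using g gT psb by (auto intro!: sphere_bounded_integrable sphere_bounded_intros)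
  have int1: "integrable sphere_measure (\<lambda>y. (1 - x \<bullet> y) * ?\<phi> y)"
    by (intro integrable_sphere_measure_continuous continuous_intros)
  have K0: "(\<integral>y. ?\<phi> y \<partial>sphere_measure) \<ge> 0"
    by (rule integral_nonneg_AE)
      (use AE_sphere_measure x in \<open>auto elim!: eventually_mono intro!: phi_nonneg abs_inner_sphere_le_1\<close>)
  have meas: "(\<lambda>y. (g y - g x) * ?\<phi> y) \<in> borel_measurable borel"
    using sphere_bounded_mult[OF sphere_bounded_diff[OF g sphere_bounded_const] psb]
    by (simp add: sphere_bounded_def)
  have "(\<integral>y. (g (T y) - g x) * ?\<phi> y \<partial>sphere_measure) = (\<integral>y. (g y - g x) * ?\<phi> y \<partial>sphere_measure)"
    using integral_sphere_measure_orthogonal[OF T meas] by (simp add: \<phi>T)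
  then have "2 * (\<integral>y. (g y - g x) * ?\<phi> y \<partial>sphere_measure)
     = (\<integral>y. (g y - g x) * ?\<phi> y \<partial>sphere_measure) + (\<integral>y. (g (T y) - g x) * ?\<phi> y \<partial>sphere_measure)" by simp
  also have "\<dots> = (\<integral>y. (g y - g x) * ?\<phi> y + (g (T y) - g x) * ?\<phi> y \<partial>sphere_measure)"
    by (rule Bochner_Integration.integral_add[OF int(1,2), symmetric])
  also have "\<dots> = (\<integral>y. (g y + g (T y) - 2 * g x) * ?\<phi> y \<partial>sphere_measure)"
    by (intro Bochner_Integration.integral_cong) (auto simp: algebra_simps)
  finally have sym: "2 * (\<integral>y. (g y - g x) * ?\<phi> y \<partial>sphere_measure)
     = (\<integral>y. (g y + g (T y) - 2 * g x) * ?\<phi> y \<partial>sphere_measure)" .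
  have "\<bar>\<integral>y. (g y + g (T y) - 2 * g x) * ?\<phi> y \<partial>sphere_measure\<bar>
     \<le> (\<integral>y. \<bar>(g y + g (T y) - 2 * g x) * ?\<phi> y\<bar> \<partial>sphere_measure)"
    by (rule integral_abs_bound)
  also have "\<dots> \<le> (\<integral>y. A * ((1 - x \<bullet> y) * ?\<phi> y) \<partial>sphere_measure)"
  proof (rule integral_mono_AE)
    show "AE y in sphere_measure. \<bar>(g y + g (T y) - 2 * g x) * ?\<phi> y\<bar> \<le> A * ((1 - x \<bullet> y) * ?\<phi> y)"
      using AE_sphere_measure
    proof eventually_elim
      case (elim y)
      have "?\<phi> y \<ge> 0" using x elim by (intro phi_nonneg abs_inner_sphere_le_1)
      then show ?case
        using mult_right_mono[OF diff[OF elim], of "?\<phi> y"] unfolding T_def by (simp add: abs_mult mult.assoc)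
    qed
  qed (use int int1 in auto)
  also have "\<dots> = A * (\<integral>y. (1 - x \<bullet> y) * ?\<phi> y \<partial>sphere_measure)" by simp
  also have "\<dots> \<le> A * (CARD('n) / real (2 * k) * (\<integral>y. ?\<phi> y \<partial>sphere_measure))"
    using phi_first_moment_le[OF x, of "2 * k"] k A by (intro mult_left_mono) auto
  finally have "2 * \<bar>\<integral>y. (g y - g x) * ?\<phi> y \<partial>sphere_measure\<bar>
    \<le> A * (CARD('n) / real (2 * k) * (\<integral>y. ?\<phi> y \<partial>sphere_measure))"
    unfolding sym[symmetric] by (simp add: abs_mult)
  moreover have "A * (CARD('n) / real (2 * k) * (\<integral>y. ?\<phi> y \<partial>sphere_measure))
    \<le> 2 * (A * CARD('n) / k * (\<integral>y. ?\<phi> y \<partial>sphere_measure))"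
    using A K0 k by (simp add: field_simps)
  ultimately show ?thesis by linarith
qed

text \<open>Rounding down a real number that is at least 1 loses at most a factor of two; this is
  where the constants 2 come from.\<close>

lemma bandwidth_bounds:
  assumes d: "d \<ge> 1" and k: "k = nat \<lfloor>real d powr (4/3)\<rfloor>"
  shows "k \<ge> 1" "real k \<le> real d powr (4/3)" "1 / real k \<le> 2 * real d powr (-4/3)"
    "1 / sqrt (real k) \<le> 2 * real d powr (-2/3)"
proof -
  define D where "D = real d powr (4/3)"
  have D: "D \<ge> 1" using d by (simp add: D_def ge_one_powr_ge_zero)
  have kr: "real k = of_int \<lfloor>D\<rfloor>" using D by (simp add: k D_def)
  show k1: "k \<ge> 1" using D unfolding k D_def[symmetric] by linarith
  show "real k \<le> real d powr (4/3)" unfolding kr D_def[symmetric] by simp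
  \<comment> \<open>\<open>D < k + 1 \<le> 2 * k\<close>.\<close>
  have half: "D / 2 \<le> real k" using D k1 kr by linarith
  then have "1 / real k \<le> 1 / (D / 2)" using D k1 by (intro divide_left_mono) auto
  also have "\<dots> = 2 * real d powr (-4/3)" by (simp add: D_def powr_minus_divide)
  finally show 1: "1 / real k \<le> 2 * real d powr (-4/3)" .
  have "(1 / sqrt (real k))\<^sup>2 \<le> (2 * real d powr (-2/3))\<^sup>2"
  proof -
    have "(real d powr (-2/3))\<^sup>2 = real d powr (-4/3)"
      using d by (simp add: power2_eq_square flip: powr_add)
    moreover have "(1 / sqrt (real k))\<^sup>2 = 1 / real k" by (simp add: power_divide)
    ultimately show ?thesis using 1 by (simp add: power_mult_distrib) (smt (verit) powr_ge_zero)
  qed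
  then show "1 / sqrt (real k) \<le> 2 * real d powr (-2/3)"
    by (rule power2_le_imp_le) simp
qed

text \<open>Put \<open>z = d powr (2/3)\<close>. Then \<open>k \<le> z ^ 2\<close> gives
  \<open>d ^ 2 / k \<ge> z\<close>, so the product is at most a constant times
  \<open>z ^ (2 * N) * exp (- 2 * z)\<close>, and the exponential absorbs any power of
  \<open>z\<close>.\<close>

lemma truncation_error_rate:
  assumes d: "d \<ge> 1" and k: "k = nat \<lfloor>real d powr (4/3)\<rfloor>"
  shows "(2 * exp (- (real d)\<^sup>2 / real k))\<^sup>2 * (2 * real (2 * k) ^ N)
    \<le> 8 * 2 ^ N * real (2 * N + 2) ^ (2 * N + 2) * real d powr (-4/3)"
proof -
  define z where "z = real d powr (2/3)"
  \<comment> \<open>Two more than the power \<open>2 * N\<close> to be absorbed, which leaves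
    \<open>1 / z ^ 2\<close>, the rate \<open>d powr (-4/3)\<close>.\<close>
  define n where "n = 2 * N + 2"
  have z: "z > 0" using d by (simp add: z_def)
  have z2: "z\<^sup>2 = real d powr (4/3)" using d by (simp add: z_def power2_eq_square flip: powr_add)
  have z3: "z ^ 3 = (real d)\<^sup>2"
  proof -
    have "z ^ 3 = real d powr 2" using d by (simp add: z_def power3_eq_cube flip: powr_add)
    then show ?thesis using d by (simp add: powr_numeral)
  qed
  note kb = bandwidth_bounds[OF d k]
  have "real k * z \<le> z\<^sup>2 * z" using kb(2) z by (intro mult_right_mono) (auto simp: z2)
  also have "z\<^sup>2 * z = (real d)\<^sup>2" unfolding z3[symmetric] by (simp add: power2_eq_square power3_eq_cube)
  finally have "z \<le> (real d)\<^sup>2 / real k" using kb(1) by (simp add: field_simps)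
  then have e1: "exp (- (real d)\<^sup>2 / real k) \<le> exp (- z)" by simp
  have "(z / n) ^ n \<le> (1 + (2 * z) / n) ^ n"
    using z by (intro power_mono) (auto simp: n_def field_simps)
  also have "\<dots> \<le> exp (2 * z)"
    using z by (intro exp_ge_one_plus_x_over_n_power_n) (auto simp: n_def)
  finally have e2: "(z / n) ^ n \<le> exp (2 * z)" .
  have "(2 * exp (- (real d)\<^sup>2 / real k))\<^sup>2 * (2 * real (2 * k) ^ N)
      \<le> (2 * exp (- z))\<^sup>2 * (2 * (2 * z\<^sup>2) ^ N)"
    using e1 kb(2) by (intro mult_mono power_mono) (auto simp: z2)
  also have "\<dots> = 8 * 2 ^ N * (z ^ (2 * N) / exp (2 * z))"
    unfolding power_mult_distrib power_mult exp_minus exp_double by (simp add: field_simps)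
  also have "\<dots> \<le> 8 * 2 ^ N * (z ^ (2 * N) / (z / n) ^ n)"
    using e2 z by (intro mult_left_mono divide_left_mono) (auto simp: n_def)
  also have "z ^ (2 * N) / (z / n) ^ n = real n ^ n / z\<^sup>2"
    using z by (simp add: n_def power_divide power_add power2_eq_square)
  also have "\<dots> = real n ^ n * real d powr (-4/3)"
    by (simp add: z2 powr_minus_divide)
  finally show ?thesis unfolding n_def by (simp add: mult.assoc)
qed

section \<open>Collecting the constants\<close>

theorem theorem4p14:
  shows
  "(\<forall>m M L1. 0 < m \<longrightarrow> m \<le> M \<longrightarrow> (\<exists>C. \<forall>f :: real^'n \<Rightarrow> real.
      f \<in> borel_measurable borel \<and>
      prob_space (density sphere_measure (\<lambda>y. ennreal (f y))) \<and>
      (\<forall>y\<in>sphere 0 1. m \<le> f y \<and> f y \<le> M) \<and>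
      (\<exists>G'. C1_on (- {0}) (sph_ext (\<lambda>y. 1 / f y)) G' \<and>
            (\<forall>y\<in>sphere 0 1. norm (G' y) \<le> L1))
      \<longrightarrow> (\<forall>d\<ge>1. \<forall>x\<in>sphere 0 1.
             \<bar>ghat f d x - 1 / f x\<bar> \<le> C * real d powr (-2/3))))
   \<and>
   (\<forall>m M L1 L2. 0 < m \<longrightarrow> m \<le> M \<longrightarrow> (\<exists>C. \<forall>f :: real^'n \<Rightarrow> real.
      f \<in> borel_measurable borel \<and>
      prob_space (density sphere_measure (\<lambda>y. ennreal (f y))) \<and>
      (\<forall>y\<in>sphere 0 1. m \<le> f y \<and> f y \<le> M) \<and>
      (\<exists>G' G''. C1_on (- {0}) (sph_ext (\<lambda>y. 1 / f y)) G' \<and> C1_on (- {0}) G' G'' \<and>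
            (\<forall>y\<in>sphere 0 1. norm (G' y) \<le> L1 \<and> norm (G'' y) \<le> L2))
      \<longrightarrow> (\<forall>d\<ge>1. \<forall>x\<in>sphere 0 1.
             \<bar>ghat f d x - 1 / f x\<bar> \<le> C * real d powr (-4/3))))"
proof -
  define N where "N = CARD('n) - 1"
  define R where "R = 8 * 2 ^ N * real (2 * N + 2) ^ (2 * N + 2)"
  have R0: "R \<ge> 0" by (simp add: R_def)
  \<comment> \<open>The Lipschitz constant of \<open>C1_sphere_increment\<close>, with
    \<open>1 / m\<close> as upper bound for \<open>1 / f\<close>.\<close>
  define A where "A m L1 = 16 * L1\<^sup>2 + (1 / m)\<^sup>2" for m L1 :: real
  have A0: "A m L1 \<ge> 0" for m L1 by (simp add: A_def)
  \<comment> \<open>Collects the last two terms of \<open>ghat_error_bound\<close>, both of order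
    \<open>d powr (-4/3)\<close>; the first 2 comes from bounding \<open>1 / k\<close>.\<close>
  define c where "c m M L1 = 2 * (M * A m L1 * CARD('n)) + 2 * M / m\<^sup>2 * R" for m M L1
  have c0: "c m M L1 \<ge> 0" if "0 < m" "m \<le> M" for m M L1
    using that A0[of m L1] R0 by (simp add: c_def)
  have g: "0 \<le> 1 / f y \<and> 1 / f y \<le> 1 / m"
    if "0 < m" "\<forall>y\<in>sphere 0 1. m \<le> f y \<and> f y \<le> M" "y \<in> sphere 0 1"
    for f :: "real^'n \<Rightarrow> real" and m M y
  proof -
    have "m \<le> f y" using that by blast
    then show ?thesis using that(1) by (auto intro!: divide_left_mono)
  qed
  \<comment> \<open>The part common to both regularity classes; the bias \<open>b\<close> is left
    open.\<close>
  have main: "\<bar>ghat f d x - 1 / f x\<bar> \<le> b + c m M L1 * real d powr (-4/3)"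
    if f: "f \<in> borel_measurable borel" and m: "0 < m" "m \<le> M"
      and fb: "\<forall>y\<in>sphere 0 1. m \<le> f y \<and> f y \<le> M"
      and C1: "C1_on (- {0}) (sph_ext (\<lambda>y. 1 / f y)) G'" and L: "\<forall>y\<in>sphere 0 1. norm (G' y) \<le> L1"
      and d: "d \<ge> 1" and x: "norm x = 1" and k: "k = nat \<lfloor>real d powr (4/3)\<rfloor>"
      and bias: "\<bar>\<integral>y. (1 / f y - 1 / f x) * phi x (2 * k) y \<partial>sphere_measure\<bar>
        \<le> b * (\<integral>y. phi x (2 * k) y \<partial>sphere_measure)"
    for f :: "real^'n \<Rightarrow> real" and m M L1 G' d x b k
  proof -
    note kb = bandwidth_bounds[OF d k]
    have lip: "(1 / f y - 1 / f x)\<^sup>2 \<le> A m L1 * (1 - x \<bullet> y)" if "y \<in> sphere 0 1" for y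
      unfolding A_def using C1_sphere_increment[OF C1 L g[OF m(1) fb] x that] .
    have "\<bar>ghat f d x - 1 / f x\<bar> \<le> b + M * A m L1 * CARD('n) / k +
      2 * M / m\<^sup>2 * ((2 * exp (- (real d)\<^sup>2 / real k))\<^sup>2 * (2 * real (2 * k) ^ N))"
      unfolding N_def by (rule ghat_error_bound[OF f m(1) fb x k kb(1) lip bias])
    also have "\<dots> \<le> b + M * A m L1 * CARD('n) * (2 * real d powr (-4/3)) + 2 * M / m\<^sup>2 * (R * real d powr (-4/3))"
    proof (intro add_mono order.refl)
      have "M * A m L1 * CARD('n) / k = M * A m L1 * CARD('n) * (1 / k)" by simp
      also have "\<dots> \<le> M * A m L1 * CARD('n) * (2 * real d powr (-4/3))"
        using kb(3) m A0[of m L1] by (intro mult_left_mono) auto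
      finally show "M * A m L1 * CARD('n) / k \<le> M * A m L1 * CARD('n) * (2 * real d powr (-4/3))" .
      show "2 * M / m\<^sup>2 * ((2 * exp (- (real d)\<^sup>2 / real k))\<^sup>2 * (2 * real (2 * k) ^ N))
         \<le> 2 * M / m\<^sup>2 * (R * real d powr (-4/3))"
        using truncation_error_rate[OF d k, of N] m unfolding R_def by (intro mult_left_mono) auto
    qed
    also have "\<dots> = b + c m M L1 * real d powr (-4/3)" by (simp add: c_def algebra_simps)
    finally show ?thesis .
  qed
  show ?thesis
  proof (intro conjI allI impI)
    fix m M L1 :: real assume m: "0 < m" "m \<le> M"
    show "\<exists>C. \<forall>f :: real^'n \<Rightarrow> real.
      f \<in> borel_measurable borel \<and>
      prob_space (density sphere_measure (\<lambda>y. ennreal (f y))) \<and>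
      (\<forall>y\<in>sphere 0 1. m \<le> f y \<and> f y \<le> M) \<and>
      (\<exists>G'. C1_on (- {0}) (sph_ext (\<lambda>y. 1 / f y)) G' \<and>
            (\<forall>y\<in>sphere 0 1. norm (G' y) \<le> L1))
      \<longrightarrow> (\<forall>d\<ge>1. \<forall>x\<in>sphere 0 1.
             \<bar>ghat f d x - 1 / f x\<bar> \<le> C * real d powr (-2/3))"
    proof (intro exI allI impI ballI, elim conjE exE)
      fix f :: "real^'n \<Rightarrow> real" and d :: nat and x :: "real^'n" and G'
      assume f: "f \<in> borel_measurable borel" and fb: "\<forall>y\<in>sphere 0 1. m \<le> f y \<and> f y \<le> M"
        and C1: "C1_on (- {0}) (sph_ext (\<lambda>y. 1 / f y)) G'" and L: "\<forall>y\<in>sphere 0 1. norm (G' y) \<le> L1"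
        and d: "1 \<le> d" and "x \<in> sphere 0 1"
      then have x: "norm x = 1" by simp
      define k where "k = nat \<lfloor>real d powr (4/3)\<rfloor>"
      note kb = bandwidth_bounds[OF d k_def]
      have "\<bar>ghat f d x - 1 / f x\<bar> \<le> (A m L1 * CARD('n) + 1) / sqrt k + c m M L1 * real d powr (-4/3)"
      proof (rule main[OF f m fb C1 L d x k_def])
        show "\<bar>\<integral>y. (1 / f y - 1 / f x) * phi x (2 * k) y \<partial>sphere_measure\<bar>
          \<le> (A m L1 * CARD('n) + 1) / sqrt k * (\<integral>y. phi x (2 * k) y \<partial>sphere_measure)"
        proof (rule C1_bias_bound[OF _ x kb(1) _ A0])
          show "sphere_bounded (\<lambda>y. 1 / f y - 1 / f x)"
            by (intro sphere_bounded_diff sphere_bounded_const sphere_bounded_density(2)[OF f m(1) fb])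
          show "(1 / f y - 1 / f x)\<^sup>2 \<le> A m L1 * (1 - x \<bullet> y)" if "y \<in> sphere 0 1" for y
            unfolding A_def using C1_sphere_increment[OF C1 L g[OF m(1) fb] x that] .
        qed
      qed
      also have "\<dots> \<le> (A m L1 * CARD('n) + 1) * (2 * real d powr (-2/3)) + c m M L1 * real d powr (-2/3)"
      proof (rule add_mono)
        have "(A m L1 * CARD('n) + 1) * (1 / sqrt k) \<le> (A m L1 * CARD('n) + 1) * (2 * real d powr (-2/3))"
          using kb(4) A0[of m L1] by (intro mult_left_mono) auto
        then show "(A m L1 * CARD('n) + 1) / sqrt k \<le> (A m L1 * CARD('n) + 1) * (2 * real d powr (-2/3))" by simp
        \<comment> \<open>Here \<open>d \<ge> 1\<close> lets the bias rate absorb the faster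
          remaining terms.\<close>
        show "c m M L1 * real d powr (-4/3) \<le> c m M L1 * real d powr (-2/3)"
          using d c0[OF m] by (intro mult_left_mono powr_mono) auto
      qed
      also have "\<dots> = (2 * (A m L1 * CARD('n) + 1) + c m M L1) * real d powr (-2/3)"
        by (simp add: algebra_simps)
      \<comment> \<open>This inequality fixes the witness for \<open>C\<close>; it involves only
        \<open>n\<close>, \<open>m\<close>, \<open>M\<close> and \<open>L1\<close>.\<close>
      finally show "\<bar>ghat f d x - 1 / f x\<bar> \<le> (2 * (A m L1 * CARD('n) + 1) + c m M L1) * real d powr (-2/3)" .
    qed
  next
    fix m M L1 L2 :: real assume m: "0 < m" "m \<le> M"
    \<comment> \<open>The constant of \<open>C2_sphere_second_difference\<close>, again with
      \<open>1 / m\<close> as upper bound for \<open>1 / f\<close>.\<close>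
    define B where "B = 16 * (L1 + L2) + 1 / m"
    show "\<exists>C. \<forall>f :: real^'n \<Rightarrow> real.
      f \<in> borel_measurable borel \<and>
      prob_space (density sphere_measure (\<lambda>y. ennreal (f y))) \<and>
      (\<forall>y\<in>sphere 0 1. m \<le> f y \<and> f y \<le> M) \<and>
      (\<exists>G' G''. C1_on (- {0}) (sph_ext (\<lambda>y. 1 / f y)) G' \<and> C1_on (- {0}) G' G'' \<and>
            (\<forall>y\<in>sphere 0 1. norm (G' y) \<le> L1 \<and> norm (G'' y) \<le> L2))
      \<longrightarrow> (\<forall>d\<ge>1. \<forall>x\<in>sphere 0 1.
             \<bar>ghat f d x - 1 / f x\<bar> \<le> C * real d powr (-4/3))"
    proof (intro exI allI impI ballI, elim conjE exE)
      fix f :: "real^'n \<Rightarrow> real" and d :: nat and x :: "real^'n" and G' G''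
      assume f: "f \<in> borel_measurable borel" and fb: "\<forall>y\<in>sphere 0 1. m \<le> f y \<and> f y \<le> M"
        and C1: "C1_on (- {0}) (sph_ext (\<lambda>y. 1 / f y)) G'" and C2: "C1_on (- {0}) G' G''"
        and L: "\<forall>y\<in>sphere 0 1. norm (G' y) \<le> L1 \<and> norm (G'' y) \<le> L2"
        and d: "1 \<le> d" and "x \<in> sphere 0 1"
      then have x: "norm x = 1" by simp
      define k where "k = nat \<lfloor>real d powr (4/3)\<rfloor>"
      note kb = bandwidth_bounds[OF d k_def]
      have L': "\<forall>y\<in>sphere 0 1. norm (G' y) \<le> L1" using L by blast
      have "norm (G' x) \<le> L1" "norm (G'' x) \<le> L2" using L x by auto
      \<comment> \<open>\<open>L1\<close> and \<open>L2\<close> are arbitrary reals in the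
        statement; their signs follow from the norm bounds at the point \<open>x\<close>.\<close>
      then have "L1 \<ge> 0" "L2 \<ge> 0" using norm_ge_zero order.trans by blast+
      then have B0: "B \<ge> 0" using m by (simp add: B_def)
      have "\<bar>ghat f d x - 1 / f x\<bar> \<le> B * CARD('n) / k + c m M L1 * real d powr (-4/3)"
      proof (rule main[OF f m fb C1 L' d x k_def])
        show "\<bar>\<integral>y. (1 / f y - 1 / f x) * phi x (2 * k) y \<partial>sphere_measure\<bar>
          \<le> B * CARD('n) / k * (\<integral>y. phi x (2 * k) y \<partial>sphere_measure)"
        proof (rule C2_bias_bound[OF sphere_bounded_density(2)[OF f m(1) fb] x kb(1) _ B0])
          show "\<bar>1 / f y + 1 / f ((2 * (x \<bullet> y)) *\<^sub>R x - y) - 2 * (1 / f x)\<bar> \<le> B * (1 - x \<bullet> y)"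
            if "y \<in> sphere 0 1" for y
            unfolding B_def using C2_sphere_second_difference[OF C1 C2 L g[OF m(1) fb] x that] .
        qed
      qed
      also have "\<dots> \<le> B * CARD('n) * (2 * real d powr (-4/3)) + c m M L1 * real d powr (-4/3)"
      proof (rule add_right_mono)
        have "B * CARD('n) * (1 / k) \<le> B * CARD('n) * (2 * real d powr (-4/3))"
          using kb(3) B0 by (intro mult_left_mono) auto
        then show "B * CARD('n) / k \<le> B * CARD('n) * (2 * real d powr (-4/3))" by simp
      qed
      also have "\<dots> = (2 * (B * CARD('n)) + c m M L1) * real d powr (-4/3)"
        by (simp add: algebra_simps)
      finally show "\<bar>ghat f d x - 1 / f x\<bar> \<le> (2 * (B * CARD('n)) + c m M L1) * real d powr (-4/3)" .
    qed
  qed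
qed

end
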